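(* Fix $n\in\mathbb{N}$. If $\mathcal{X}$ is a computable linear ordering and $\boldsymbol\omega^{n}(\mathcal{X})$ has a computable descending sequence, then $0^{(n)}$ computes a descending sequence in $\mathcal{X}$. Conversely, there exists a computable linear ordering $\mathcal{X}$ with a computable descending sequence in $\boldsymbol\omega^{n}(\mathcal{X})$ such that the Turing jump of every descending sequence in $\mathcal{X}$ computes $0^{(n)}$.
   Context: A descending sequence in a linear ordering is an infinite strictly decreasing sequence of its elements. For a linear ordering $\mathcal{X}$, the linear ordering $\boldsymbol\omega^{\mathcal{X}}$ has as elements the finite strings $\langle x_0,\dots,x_{k-1}\rangle$ of elements of $\mathcal{X}$ (including the empty string) with $x_0\geq_{\mathcal{X}} x_1\geq_{\mathcal{X}}\dots\geq_{\mathcal{X}} x_{k-1}$ (thought of as $\omega^{x_0}+\dots+\omega^{x_{k-1}}$), ordered by: $\langle x_0,\dots,x_{k-1}\rangle\leq\langle y_0,\dots,y_{l-1}\rangle$ iff either $k\leq l$ and $x_i=y_i$ for all $i<k$, or at the least $i$ with $x_i\neq y_i$ we have $x_i<_{\mathcal{X}} y_i$. Iterates: $\boldsymbol\omega^{0}(\mathcal{X})=\mathcal{X}$ and $\boldsymbol\omega^{n+1}(\mathcal{X})=\boldsymbol\omega^{\boldsymbol\omega^{n}(\mathcal{X})}$. $0^{(n)}$ denotes the $n$-th Turing jump of the empty set. *)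

theory Defs
  imports Main "HOL-Library.Nat_Bijection"
begin

datatype recf = Zero | Succ | Proj nat | Orc | Comp recf "recf list"
  | Prim recf recf | Mu recf

inductive reval :: "(nat \<Rightarrow> nat) \<Rightarrow> recf \<Rightarrow> nat list \<Rightarrow> nat \<Rightarrow> bool" for A where
  zero: "reval A Zero xs 0"
| succ: "reval A Succ (x # xs) (Suc x)"
| proj: "i < length xs \<Longrightarrow> reval A (Proj i) xs (xs ! i)"
| orc: "reval A Orc (x # xs) (A x)"
| comp: "length ys = length gs \<Longrightarrow> (\<forall>i<length gs. reval A (gs ! i) xs (ys ! i))
          \<Longrightarrow> reval A f ys z \<Longrightarrow> reval A (Comp f gs) xs z"
| prim0: "reval A f xs y \<Longrightarrow> reval A (Prim f g) (0 # xs) y"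
| primS: "reval A (Prim f g) (n # xs) y \<Longrightarrow> reval A g (y # n # xs) z
          \<Longrightarrow> reval A (Prim f g) (Suc n # xs) z"
| mu: "reval A f (n # xs) 0 \<Longrightarrow> (\<forall>m<n. \<exists>y. 0 < y \<and> reval A f (m # xs) y)
          \<Longrightarrow> reval A (Mu f) xs n"

definition computable_in :: "(nat \<Rightarrow> nat) \<Rightarrow> (nat \<Rightarrow> nat) \<Rightarrow> bool" where
  "computable_in A g \<longleftrightarrow> (\<exists>f. \<forall>x. reval A f [x] (g x))"

definition computable :: "(nat \<Rightarrow> nat) \<Rightarrow> bool" where
  "computable g \<longleftrightarrow> computable_in (\<lambda>_. 0) g"

definition chi :: "nat set \<Rightarrow> nat \<Rightarrow> nat" where
  "chi S x = (if x \<in> S then 1 else 0)"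

primrec enc :: "recf \<Rightarrow> nat" where
  "enc Zero = prod_encode (0, 0)"
| "enc Succ = prod_encode (1, 0)"
| "enc (Proj i) = prod_encode (2, i)"
| "enc Orc = prod_encode (3, 0)"
| "enc (Comp f gs) = prod_encode (4, prod_encode (enc f, list_encode (map enc gs)))"
| "enc (Prim f g) = prod_encode (5, prod_encode (enc f, enc g))"
| "enc (Mu f) = prod_encode (6, enc f)"

definition jump :: "(nat \<Rightarrow> nat) \<Rightarrow> nat set" where
  "jump A = {e. \<exists>f. enc f = e \<and> (\<exists>y. reval A f [e] y)}"

primrec jumpn :: "nat \<Rightarrow> nat set" where
  "jumpn 0 = {}"
| "jumpn (Suc n) = jump (chi (jumpn n))"

type_synonym lo = "nat set \<times> (nat \<times> nat) set"

definition comp_lin_order :: "lo \<Rightarrow> bool" where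
  "comp_lin_order X \<longleftrightarrow> (case X of (D, R) \<Rightarrow>
     R \<subseteq> D \<times> D \<and> linear_order_on D R \<and>
     computable (chi D) \<and> computable (chi (prod_encode ` R)))"

definition descending :: "lo \<Rightarrow> (nat \<Rightarrow> nat) \<Rightarrow> bool" where
  "descending X f \<longleftrightarrow> (case X of (D, R) \<Rightarrow>
     (\<forall>i. f i \<in> D \<and> (f (Suc i), f i) \<in> R \<and> f (Suc i) \<noteq> f i))"

definition omega_strings :: "lo \<Rightarrow> nat list set" where
  "omega_strings X = {xs. set xs \<subseteq> fst X \<and> sorted_wrt (\<lambda>a b. (b, a) \<in> snd X) xs}"

definition omega_le :: "(nat \<times> nat) set \<Rightarrow> nat list \<Rightarrow> nat list \<Rightarrow> bool" where
  "omega_le R xs ys \<longleftrightarrow>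
     (length xs \<le> length ys \<and> take (length xs) ys = xs) \<or>
     (\<exists>i < min (length xs) (length ys). take i xs = take i ys \<and>
        xs ! i \<noteq> ys ! i \<and> (xs ! i, ys ! i) \<in> R)"

definition omega_exp :: "lo \<Rightarrow> lo" where
  "omega_exp X = (list_encode ` omega_strings X,
     {(list_encode xs, list_encode ys) | xs ys.
        xs \<in> omega_strings X \<and> ys \<in> omega_strings X \<and> omega_le (snd X) xs ys})"

definition omega_iter :: "nat \<Rightarrow> lo \<Rightarrow> lo" where
  "omega_iter n X = (omega_exp ^^ n) X"

end

(*
  Reduction from omega^n(X) to X.  In a descending sequence of strings, either some prefix
  stabilises while the next entry does not, and that entry yields a descending sequence
  directly, or all prefixes stabilise, and the limit entries, computable from one jump, contain
  a descending subsequence.  So each exponential costs one jump.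

  The ordering X.  Following Marcone and Montalban, iterate the true stage construction: at
  stage t the tree order of level k + 1 keeps those level k predecessors of t whose guesses about
  the halting of programs 0, 1, 2, ... relative to the level k oracle have not been refuted.
  Let X be the Kleene-Brouwer order of the level n tree on the stages.  A descending sequence in
  X converges to a path, which its jump computes, and a path of level n computes the n-th jump.
  Conversely, replacing a stage t by the formal sum of omega^u over the level k + 1 predecessors u
  whose current guess is still "diverges" (a guess that can be revised only once), followed by two
  copies of omega^t, turns a map on level k + 1 that decreases along the tree into one on level k.
  Since level 0 is the chain of all stages, n such steps give a computable descending sequence.
*)
theory Submission
  imports Defs
begin

section \<open>Closure properties of relative computability\<close>

text \<open>The oracle at level \<open>k\<close> is not \<open>jumpn k\<close> but an infinite path
  of the level \<open>k\<close> tree, a plain sequence of stages. Its initial segments are the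
  chains themselves, so halting relative to them is decidable and every level is computable without
  an oracle, although the infinite paths compute iterated jumps. What shapes the converse is that
  \<open>X\<close> is linear, while a stage knows only its own predecessors: stages incomparable in
  the tree are related merely by the Kleene-Brouwer tie-break. So the maps are only required to
  decrease along the tree, and each string is built from entries of a single chain, which are
  pairwise comparable there. Each exponential buys a passage to a level with more comparable stages.
  The reduction to \<open>X\<close> is not uniform: the case that holds, and the index from which a
  prefix is final, are not found effectively. This is harmless, since only the existence of a
  program is claimed.\<close>

text \<open>A fixed arity \<open>n\<close> is tracked because \<open>Prim\<close> and
  \<open>Mu\<close> change the number of arguments, so unary \<open>computable_in\<close> cannot be
  the induction invariant.\<close>

definition ncomp :: "(nat \<Rightarrow> nat) \<Rightarrow> nat \<Rightarrow> (nat list \<Rightarrow> nat) \<Rightarrow> bool" where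
  "ncomp A n F \<longleftrightarrow> (\<exists>f. \<forall>xs. length xs = n \<longrightarrow> reval A f xs (F xs))"

lemma ncompI: "(\<And>xs. length xs = n \<Longrightarrow> reval A f xs (F xs)) \<Longrightarrow> ncomp A n F"
  unfolding ncomp_def by blast

lemma ncompE:
  assumes "ncomp A n F"
  obtains f where "\<And>xs. length xs = n \<Longrightarrow> reval A f xs (F xs)"
  using assms unfolding ncomp_def by blast

lemma ncomp_cong:
  "ncomp A n F \<Longrightarrow> (\<And>xs. length xs = n \<Longrightarrow> F xs = G xs) \<Longrightarrow> ncomp A n G"
  unfolding ncomp_def by fastforce

lemma ncomp_proj: "i < n \<Longrightarrow> ncomp A n (\<lambda>xs. xs ! i)"
  by (rule ncompI[where f="Proj i"]) (auto intro: reval.proj)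

lemma ncomp_zero: "ncomp A n (\<lambda>xs. 0)"
  by (rule ncompI[where f=Zero]) (rule reval.zero)

lemma ncomp_comp:
  assumes G: "ncomp A (length Fs) G" and Fs: "\<And>F. F \<in> set Fs \<Longrightarrow> ncomp A n F"
  shows "ncomp A n (\<lambda>xs. G (map (\<lambda>F. F xs) Fs))"
proof -
  obtain g where g: "\<And>xs. length xs = length Fs \<Longrightarrow> reval A g xs (G xs)"
    using ncompE[OF G] by blast
  have "\<forall>F\<in>set Fs. \<exists>f. \<forall>xs. length xs = n \<longrightarrow> reval A f xs (F xs)"
    using Fs unfolding ncomp_def by blast
  then obtain h where h: "\<And>F xs. F \<in> set Fs \<Longrightarrow> length xs = n \<Longrightarrow> reval A (h F) xs (F xs)"
    by metis
  show ?thesis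
    by (rule ncompI[where f="Comp g (map h Fs)"],
        rule reval.comp[where ys="map (\<lambda>F. F _) Fs"]) (auto intro: h g)
qed

lemma ncomp_comp1:
  assumes "ncomp A 1 (\<lambda>xs. h (xs ! 0))" "ncomp A n F"
  shows "ncomp A n (\<lambda>xs. h (F xs))"
  using ncomp_comp[where Fs="[F]" and G="\<lambda>xs. h (xs ! 0)" and n=n] assms by simp

lemma ncomp_Suc:
  assumes "ncomp A n F"
  shows "ncomp A n (\<lambda>xs. Suc (F xs))"
proof (rule ncomp_comp1[OF _ assms])
  show "ncomp A 1 (\<lambda>xs. Suc (xs ! 0))"
    by (rule ncompI[where f=Succ]) (auto simp: length_Suc_conv intro: reval.succ)
qed

lemma ncomp_oracle:
  assumes "ncomp A n F"
  shows "ncomp A n (\<lambda>xs. A (F xs))"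
proof (rule ncomp_comp1[OF _ assms])
  show "ncomp A 1 (\<lambda>xs. A (xs ! 0))"
    by (rule ncompI[where f=Orc]) (auto simp: length_Suc_conv intro: reval.orc)
qed

lemma ncomp_prim:
  assumes "ncomp A n a" "ncomp A (Suc (Suc n)) s"
  shows "ncomp A (Suc n) (\<lambda>xs. rec_nat (a (tl xs)) (\<lambda>m r. s (r # m # tl xs)) (xs ! 0))"
proof -
  obtain f where f: "\<And>xs. length xs = n \<Longrightarrow> reval A f xs (a xs)"
    using ncompE[OF assms(1)] by blast
  obtain g where g: "\<And>xs. length xs = Suc (Suc n) \<Longrightarrow> reval A g xs (s xs)"
    using ncompE[OF assms(2)] by blast
  have *: "reval A (Prim f g) (m # xs) (rec_nat (a xs) (\<lambda>m r. s (r # m # xs)) m)"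
    if "length xs = n" for m xs
    by (induction m) (use that in \<open>auto intro!: reval.prim0 reval.primS f g\<close>)
  show ?thesis
    by (rule ncompI[where f="Prim f g"]) (auto simp: length_Suc_conv intro!: *)
qed

lemma ncomp_Mu:
  assumes "ncomp A (Suc n) f" and ex: "\<And>xs. length xs = n \<Longrightarrow> \<exists>m. f (m # xs) = 0"
  shows "ncomp A n (\<lambda>xs. LEAST m. f (m # xs) = 0)"
proof -
  obtain g where g: "\<And>xs. length xs = Suc n \<Longrightarrow> reval A g xs (f xs)"
    using ncompE[OF assms(1)] by blast
  show ?thesis
  proof (rule ncompI[where f="Mu g"], rule reval.mu)
    fix xs :: "nat list" assume l: "length xs = n"
    show "reval A g ((LEAST m. f (m # xs) = 0) # xs) 0"
      using g[of "(LEAST m. f (m # xs) = 0) # xs"] LeastI_ex[OF ex[OF l]] l by simp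
    show "\<forall>m<(LEAST m. f (m # xs) = 0). \<exists>y. 0 < y \<and> reval A g (m # xs) y"
    proof (intro allI impI)
      fix m assume "m < (LEAST m. f (m # xs) = 0)"
      then have "f (m # xs) \<noteq> 0" using not_less_Least by blast
      then show "\<exists>y. 0 < y \<and> reval A g (m # xs) y"
        using g[of "m # xs"] l by auto
    qed
  qed
qed

lemma computable_in_iff_ncomp: "computable_in A g \<longleftrightarrow> ncomp A 1 (\<lambda>xs. g (xs ! 0))"
proof -
  have "(\<forall>x. reval A f [x] (g x)) \<longleftrightarrow> (\<forall>xs. length xs = 1 \<longrightarrow> reval A f xs (g (xs ! 0)))" for f
    by (auto simp: length_Suc_conv)
  then show ?thesis unfolding computable_in_def ncomp_def by simp
qed

lemma computable_in_comp:
  "computable_in A h \<Longrightarrow> computable_in A f \<Longrightarrow> computable_in A (\<lambda>x. h (f x))"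
  unfolding computable_in_iff_ncomp by (rule ncomp_comp1)

text \<open>\<open>Prim\<close> consumes its first argument; feeding it \<open>b\<close> together
  with all projections keeps the whole argument list available as parameters.\<close>

lemma ncomp_rec2:
  assumes "ncomp A n a" "ncomp A (Suc (Suc n)) s" "ncomp A n b"
  shows "ncomp A n (\<lambda>xs. rec_nat (a xs) (\<lambda>m r. s (r # m # xs)) (b xs))"
proof -
  have *: "ncomp A n (\<lambda>xs. (\<lambda>xs. rec_nat (a (tl xs)) (\<lambda>m r. s (r # m # tl xs)) (xs ! 0))
      (map (\<lambda>F. F xs) (b # map (\<lambda>i xs. xs ! i) [0..<n])))"
    by (rule ncomp_comp) (use assms in \<open>auto intro: ncomp_prim ncomp_proj\<close>)
  show ?thesis
  proof (rule ncomp_cong[OF *])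
    fix xs :: "nat list" assume "length xs = n"
    then have "map ((\<lambda>F. F xs) \<circ> (\<lambda>i xs. xs ! i)) [0..<n] = xs"
      by (auto simp: comp_def map_nth)
    then show "rec_nat (a (tl (map (\<lambda>F. F xs) (b # map (\<lambda>i xs. xs ! i) [0..<n]))))
        (\<lambda>m r. s (r # m # tl (map (\<lambda>F. F xs) (b # map (\<lambda>i xs. xs ! i) [0..<n]))))
        (map (\<lambda>F. F xs) (b # map (\<lambda>i xs. xs ! i) [0..<n]) ! 0) =
        rec_nat (a xs) (\<lambda>m r. s (r # m # xs)) (b xs)" by simp
  qed
qed

lemma ncomp_add: "ncomp A n F \<Longrightarrow> ncomp A n G \<Longrightarrow> ncomp A n (\<lambda>xs. F xs + G xs)"
proof -
  assume "ncomp A n F" "ncomp A n G"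
  moreover have "rec_nat a (\<lambda>m r. Suc r) b = a + b" for a b by (induction b) auto
  ultimately show ?thesis
    using ncomp_rec2[of A n F "\<lambda>xs. Suc (xs ! 0)" G]
    by (simp add: ncomp_Suc ncomp_proj)
qed

lemma ncomp_pred: "ncomp A n F \<Longrightarrow> ncomp A n (\<lambda>xs. F xs - 1)"
proof -
  assume "ncomp A n F"
  moreover have "rec_nat 0 (\<lambda>m r. m) b = b - 1" for b :: nat by (cases b) auto
  ultimately show ?thesis
    using ncomp_rec2[of A n "\<lambda>xs. 0" "\<lambda>xs. xs ! 1" F]
    by (simp add: ncomp_zero ncomp_proj)
qed

lemma ncomp_diff: "ncomp A n F \<Longrightarrow> ncomp A n G \<Longrightarrow> ncomp A n (\<lambda>xs. F xs - G xs)"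
proof -
  assume "ncomp A n F" "ncomp A n G"
  moreover have "rec_nat a (\<lambda>m r. r - 1) b = a - b" for a b :: nat by (induction b) auto
  ultimately show ?thesis
    using ncomp_rec2[of A n F "\<lambda>xs. xs ! 0 - 1" G] ncomp_pred[OF ncomp_proj]
    by simp
qed

lemma ncomp_triangle: "ncomp A n F \<Longrightarrow> ncomp A n (\<lambda>xs. triangle (F xs))"
proof -
  assume "ncomp A n F"
  moreover have "rec_nat 0 (\<lambda>m r. r + Suc m) b = triangle b" for b :: nat
    by (induction b) auto
  ultimately show ?thesis
    using ncomp_rec2[of A n "\<lambda>xs. 0" "\<lambda>xs. xs ! 0 + Suc (xs ! 1)" F]
    by (simp add: ncomp_zero ncomp_proj ncomp_add ncomp_Suc)
qed

section \<open>Inverting the pairing function; unary functions on coded tuples\<close>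

definition pfst :: "nat \<Rightarrow> nat" where "pfst x = fst (prod_decode x)"
definition psnd :: "nat \<Rightarrow> nat" where "psnd x = snd (prod_decode x)"

lemma pfst_pair [simp]: "pfst (prod_encode (a, b)) = a"
  and psnd_pair [simp]: "psnd (prod_encode (a, b)) = b"
  and pair_pfst_psnd [simp]: "prod_encode (pfst x, psnd x) = x"
  by (simp_all add: pfst_def psnd_def)

lemma triangle_mono: "m \<le> n \<Longrightarrow> triangle m \<le> triangle n"
  by (induction n) (auto simp: le_Suc_eq)

text \<open>The code of \<open>(a, b)\<close> is \<open>triangle (a + b) + a\<close>, which lies on
  diagonal \<open>a + b\<close>. Truncated subtraction expresses that the code is below
  \<open>triangle (Suc s)\<close>, so minimisation finds the diagonal and hence inverts the
  pairing.\<close>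

lemma Least_triangle:
  "(LEAST s. Suc (prod_encode (a, b)) - triangle (Suc s) = 0) = a + b"
proof (rule Least_equality)
  fix y assume "Suc (prod_encode (a, b)) - triangle (Suc y) = 0"
  then have "triangle (a + b) < triangle (Suc y)"
    by (simp add: prod_encode_def)
  then show "a + b \<le> y" using triangle_mono[of "Suc y" "a + b"] by force
qed (simp add: prod_encode_def)

lemma ncomp_pfst_add_psnd: "ncomp A 1 (\<lambda>xs. pfst (xs ! 0) + psnd (xs ! 0))"
proof -
  have *: "(LEAST s. Suc z - triangle (Suc s) = 0) = pfst z + psnd z" for z
    using Least_triangle[of "pfst z" "psnd z"] by (simp del: triangle_Suc)
  have "ncomp A 1 (\<lambda>xs. LEAST m. (\<lambda>xs. Suc (xs ! 1) - triangle (Suc (xs ! 0))) (m # xs) = 0)"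
  proof (rule ncomp_Mu)
    show "\<exists>m. Suc ((m # xs) ! 1) - triangle (Suc ((m # xs) ! 0)) = 0" for xs
      by (rule exI[of _ "xs ! 0"]) simp
  qed (intro ncomp_diff ncomp_Suc ncomp_triangle ncomp_proj; simp)
  then show ?thesis using * by (simp del: triangle_Suc)
qed

lemma pfst_eq: "pfst z = z - triangle (pfst z + psnd z)"
proof -
  have "z = triangle (pfst z + psnd z) + pfst z"
    using pair_pfst_psnd[of z] unfolding prod_encode_def by simp
  then show ?thesis by linarith
qed

lemma computable_in_id: "computable_in A (\<lambda>x. x)"
  unfolding computable_in_iff_ncomp by (rule ncomp_proj) simp

lemma computable_in_const: "computable_in A (\<lambda>x. c)"
  unfolding computable_in_iff_ncomp
  by (induction c) (auto intro: ncomp_zero ncomp_Suc)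

lemma computable_in_Suc: "computable_in A f \<Longrightarrow> computable_in A (\<lambda>x. Suc (f x))"
  unfolding computable_in_iff_ncomp by (rule ncomp_Suc)

lemma computable_in_oracle: "computable_in A f \<Longrightarrow> computable_in A (\<lambda>x. A (f x))"
  unfolding computable_in_iff_ncomp by (rule ncomp_oracle)

lemma computable_in_add:
  "computable_in A f \<Longrightarrow> computable_in A g \<Longrightarrow> computable_in A (\<lambda>x. f x + g x)"
  unfolding computable_in_iff_ncomp by (rule ncomp_add)

lemma computable_in_diff:
  "computable_in A f \<Longrightarrow> computable_in A g \<Longrightarrow> computable_in A (\<lambda>x. f x - g x)"
  unfolding computable_in_iff_ncomp by (rule ncomp_diff)

lemma ncomp_pair: "ncomp A n F \<Longrightarrow> ncomp A n G \<Longrightarrow> ncomp A n (\<lambda>xs. prod_encode (F xs, G xs))"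
  unfolding prod_encode_def by (simp add: ncomp_add ncomp_triangle)

lemma computable_in_pair:
  "computable_in A f \<Longrightarrow> computable_in A g \<Longrightarrow> computable_in A (\<lambda>x. prod_encode (f x, g x))"
  unfolding computable_in_iff_ncomp by (rule ncomp_pair)

lemma computable_in_pfst:
  assumes "computable_in A f"
  shows "computable_in A (\<lambda>x. pfst (f x))"
proof (rule computable_in_comp[OF _ assms])
  have "ncomp A 1 (\<lambda>xs. xs ! 0 - triangle (pfst (xs ! 0) + psnd (xs ! 0)))"
    by (intro ncomp_diff ncomp_triangle ncomp_pfst_add_psnd ncomp_proj) simp
  then show "computable_in A pfst"
    unfolding computable_in_iff_ncomp using pfst_eq by simp
qed

lemma computable_in_psnd:
  assumes "computable_in A f"
  shows "computable_in A (\<lambda>x. psnd (f x))"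
proof (rule computable_in_comp[OF _ assms])
  have "computable_in A (\<lambda>x. (pfst x + psnd x) - pfst x)"
    using computable_in_pfst[OF computable_in_id] ncomp_pfst_add_psnd
    unfolding computable_in_iff_ncomp by (intro ncomp_diff)
  then show "computable_in A psnd" by simp
qed

text \<open>From here on functions are unary: counter, previous value and parameter of the recursion
  are packed into one number \<open>p\<close>.\<close>

lemma computable_in_rec:
  assumes "computable_in A a" "computable_in A b"
    "computable_in A (\<lambda>p. s (pfst p) (pfst (psnd p)) (psnd (psnd p)))"
  shows "computable_in A (\<lambda>x. rec_nat (a x) (\<lambda>n r. s n r x) (b x))"
proof -
  have "ncomp A 3 (\<lambda>xs. prod_encode (xs ! 1, prod_encode (xs ! 0, xs ! 2)))"
    by (intro ncomp_pair ncomp_proj) simp_all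
  from ncomp_comp1[OF _ this] assms(3)
  have "ncomp A 3 (\<lambda>xs. s (xs ! 1) (xs ! 0) (xs ! 2))"
    unfolding computable_in_iff_ncomp by fastforce
  then show ?thesis
    using ncomp_rec2[of A 1 "\<lambda>xs. a (xs ! 0)" "\<lambda>xs. s (xs ! 1) (xs ! 0) (xs ! 2)" "\<lambda>xs. b (xs ! 0)"]
      assms(1,2)
    unfolding computable_in_iff_ncomp by (simp add: numeral_3_eq_3 numeral_2_eq_2)
qed

section \<open>Decidable predicates and bounded search\<close>

definition decidable_in :: "(nat \<Rightarrow> nat) \<Rightarrow> (nat \<Rightarrow> bool) \<Rightarrow> bool" where
  "decidable_in A P \<longleftrightarrow> computable_in A (chi {x. P x})"

lemma decidable_in_iff: "decidable_in A P \<longleftrightarrow> computable_in A (\<lambda>x. if P x then 1 else 0)"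
  by (simp add: decidable_in_def chi_def[abs_def])

lemma computable_in_if:
  assumes "decidable_in A P" "computable_in A f" "computable_in A g"
  shows "computable_in A (\<lambda>x. if P x then f x else g x)"
proof -
  have "computable_in A (\<lambda>x. rec_nat (g x) (\<lambda>n r. f x) (if P x then 1 else 0))"
    using assms(1,3) computable_in_comp[OF assms(2), of "\<lambda>p. psnd (psnd p)"]
    by (intro computable_in_rec) (auto simp: decidable_in_iff computable_in_psnd computable_in_id)
  then show ?thesis by (rule back_subst[of "computable_in A"]) auto
qed

lemma decidable_in_le:
  assumes "computable_in A f" "computable_in A g"
  shows "decidable_in A (\<lambda>x. f x \<le> g x)"
proof -
  have "computable_in A (\<lambda>x. 1 - (f x - g x))"
    by (intro computable_in_diff computable_in_const assms)
  then show ?thesis unfolding decidable_in_iff by (rule back_subst[of "computable_in A"]) auto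
qed

lemma decidable_in_not: "decidable_in A P \<Longrightarrow> decidable_in A (\<lambda>x. \<not> P x)"
proof -
  assume "decidable_in A P"
  then have "computable_in A (\<lambda>x. if P x then 0 else 1)"
    by (intro computable_in_if computable_in_const)
  then show ?thesis unfolding decidable_in_iff by (rule back_subst[of "computable_in A"]) auto
qed

lemma decidable_in_conj:
  assumes "decidable_in A P" "decidable_in A Q"
  shows "decidable_in A (\<lambda>x. P x \<and> Q x)"
proof -
  have "computable_in A (\<lambda>x. if P x then (if Q x then 1 else 0) else 0)"
    by (intro computable_in_if computable_in_const assms)
  then show ?thesis unfolding decidable_in_iff by (rule back_subst[of "computable_in A"]) auto
qed

lemma decidable_in_disj:
  assumes "decidable_in A P" "decidable_in A Q"
  shows "decidable_in A (\<lambda>x. P x \<or> Q x)"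
  using decidable_in_not[OF decidable_in_conj[OF decidable_in_not[OF assms(1)]
        decidable_in_not[OF assms(2)]]] by simp

lemma decidable_in_less:
  "computable_in A f \<Longrightarrow> computable_in A g \<Longrightarrow> decidable_in A (\<lambda>x. f x < g x)"
  using decidable_in_not[OF decidable_in_le[of A g f]] by (simp add: not_le)

lemma decidable_in_eq:
  "computable_in A f \<Longrightarrow> computable_in A g \<Longrightarrow> decidable_in A (\<lambda>x. f x = g x)"
  using decidable_in_conj[OF decidable_in_le[of A f g] decidable_in_le[of A g f]]
  by (simp add: eq_iff)

lemma decidable_in_comp:
  "decidable_in A P \<Longrightarrow> computable_in A f \<Longrightarrow> decidable_in A (\<lambda>x. P (f x))"
  unfolding decidable_in_iff by (rule computable_in_comp)

lemma decidable_in_comp2: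
  assumes "decidable_in A (\<lambda>p. P (pfst p) (psnd p))" "computable_in A f" "computable_in A g"
  shows "decidable_in A (\<lambda>x. P (f x) (g x))"
  using decidable_in_comp[OF assms(1) computable_in_pair[OF assms(2,3)]] by simp

lemma computable_in_apply2:
  assumes "computable_in A (\<lambda>p. h (pfst p) (psnd p))" "computable_in A f" "computable_in A g"
  shows "computable_in A (\<lambda>x. h (f x) (g x))"
  using computable_in_comp[OF assms(1) computable_in_pair[OF assms(2,3)]] by simp

lemma computable_in_Least:
  assumes P: "decidable_in A (\<lambda>p. P (pfst p) (psnd p))" and ex: "\<And>x. \<exists>n. P n x"
  shows "computable_in A (\<lambda>x. LEAST n. P n x)"
proof -
  have "computable_in A (\<lambda>p. if P (pfst p) (psnd p) then 0 else 1)"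
    by (intro computable_in_if P computable_in_const)
  moreover have "ncomp A 2 (\<lambda>xs. prod_encode (xs ! 0, xs ! 1))"
    by (intro ncomp_pair ncomp_proj) auto
  ultimately have "ncomp A 2 (\<lambda>xs. if P (xs ! 0) (xs ! 1) then 0 else 1)"
    unfolding computable_in_iff_ncomp
    using ncomp_comp1[of A "\<lambda>p. if P (pfst p) (psnd p) then 0 else 1" 2
        "\<lambda>xs. prod_encode (xs ! 0, xs ! 1)"] by simp
  then have "ncomp A 1 (\<lambda>xs. LEAST m. (if P m (xs ! 0) then 0 else 1) = (0::nat))"
    using ncomp_Mu[of A 1 "\<lambda>xs. if P (xs ! 0) (xs ! 1) then 0 else 1"] ex
    by (simp add: numeral_2_eq_2)
  then show ?thesis unfolding computable_in_iff_ncomp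
    by (rule ncomp_cong) (simp cong: if_cong)
qed

text \<open>Turns bounded quantification into a search for a counterexample that always ends,
  because \<open>b\<close> itself is accepted.\<close>

lemma all_less_iff_Least: "(\<forall>i<b. P i) \<longleftrightarrow> (LEAST i. b \<le> i \<or> \<not> P i) = (b::nat)"
proof
  assume "\<forall>i<b. P i"
  then show "(LEAST i. b \<le> i \<or> \<not> P i) = b"
    by (intro Least_equality) (auto simp: not_le[symmetric])
next
  assume *: "(LEAST i. b \<le> i \<or> \<not> P i) = b"
  show "\<forall>i<b. P i"
  proof (intro allI impI)
    fix i assume "i < b"
    then have "i < (LEAST i. b \<le> i \<or> \<not> P i)" by (simp only: *)
    from not_less_Least[OF this] show "P i" by blast
  qed
qed

lemma decidable_in_all_less:
  assumes P: "decidable_in A (\<lambda>p. P (pfst p) (psnd p))" and b: "computable_in A b"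
  shows "decidable_in A (\<lambda>x. \<forall>i<b x. P i x)"
proof -
  have "computable_in A (\<lambda>x. LEAST i. b x \<le> i \<or> \<not> P i x)"
  proof (rule computable_in_Least)
    show "decidable_in A (\<lambda>p. b (psnd p) \<le> pfst p \<or> \<not> P (pfst p) (psnd p))"
      by (rule decidable_in_disj[OF decidable_in_le decidable_in_not[OF P]])
        (rule computable_in_comp[OF b] computable_in_pfst computable_in_psnd computable_in_id)+
  qed auto
  from decidable_in_eq[OF this b] show ?thesis by (simp only: all_less_iff_Least)
qed

lemma decidable_in_ex_less:
  assumes "decidable_in A (\<lambda>p. P (pfst p) (psnd p))" "computable_in A b"
  shows "decidable_in A (\<lambda>x. \<exists>i<b x. P i x)"
  using decidable_in_not[OF decidable_in_all_less[OF decidable_in_not[OF assms(1)] assms(2)]]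
  by simp

section \<open>Computable operations on lists\<close>

text \<open>Computability goals are solved by following the syntax of the term. Under a binder the
  argument becomes a pair of bound variable and old argument; this is why proofs also supply
  hypotheses composed with an arbitrary computable function.\<close>

named_theorems comp_intros

lemmas [comp_intros] =
  computable_in_id computable_in_const computable_in_Suc computable_in_add computable_in_diff
  computable_in_pair computable_in_pfst computable_in_psnd computable_in_if
  decidable_in_le decidable_in_less decidable_in_eq
  decidable_in_not decidable_in_conj decidable_in_disj
  decidable_in_all_less decidable_in_ex_less

definition list_computable_in :: "(nat \<Rightarrow> nat) \<Rightarrow> (nat \<Rightarrow> nat list) \<Rightarrow> bool" where
  "list_computable_in A F \<longleftrightarrow> computable_in A (\<lambda>x. list_encode (F x))"

text \<open>Defaults outside the list keep the closure rules free of side conditions.\<close>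

definition hd0 :: "nat list \<Rightarrow> nat" where "hd0 xs = (case xs of [] \<Rightarrow> 0 | x # _ \<Rightarrow> x)"

definition nth0 :: "nat list \<Rightarrow> nat \<Rightarrow> nat" where
  "nth0 xs i = (if i < length xs then xs ! i else 0)"

lemma nth0_nth [simp]: "i < length xs \<Longrightarrow> nth0 xs i = xs ! i"
  by (simp add: nth0_def)

lemma prod_decode_0: "prod_decode 0 = (0, 0)"
  by (simp add: prod_decode_def prod_decode_aux.simps)

text \<open>For the empty list truncated subtraction yields 0, which decodes to
  \<open>(0, 0)\<close>: this agrees with the code of \<open>tl []\<close> and with the default of
  \<open>hd0\<close>.\<close>

lemma psnd_list_encode: "psnd (list_encode xs - 1) = list_encode (tl xs)"
  by (cases xs) (simp_all add: psnd_def prod_decode_0)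

lemma pfst_list_encode: "pfst (list_encode xs - 1) = hd0 xs"
  by (cases xs) (simp_all add: pfst_def hd0_def prod_decode_0)

lemma hd0_drop: "hd0 (drop i xs) = nth0 xs i"
  by (cases "i < length xs") (simp_all add: hd0_def nth0_def Cons_nth_drop_Suc[symmetric])

lemma list_encode_eq_0 [simp]: "list_encode xs = 0 \<longleftrightarrow> xs = []"
  by (cases xs) auto

lemma list_encode_eq_iff [simp]: "list_encode xs = list_encode ys \<longleftrightarrow> xs = ys"
  by (metis list_encode_inverse)

lemma list_computable_in_comp:
  "list_computable_in A F \<Longrightarrow> computable_in A f \<Longrightarrow> list_computable_in A (\<lambda>x. F (f x))"
  unfolding list_computable_in_def by (rule computable_in_comp)

lemma list_computable_in_decode [comp_intros]:
  "computable_in A f \<Longrightarrow> list_computable_in A (\<lambda>x. list_decode (f x))"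
  by (simp add: list_computable_in_def)

lemma computable_in_list_encode [comp_intros]:
  "list_computable_in A F \<Longrightarrow> computable_in A (\<lambda>x. list_encode (F x))"
  by (simp only: list_computable_in_def)

lemma list_computable_in_const [comp_intros]: "list_computable_in A (\<lambda>x. c)"
  unfolding list_computable_in_def by (rule computable_in_const)

lemma list_computable_in_tl [comp_intros]:
  "list_computable_in A F \<Longrightarrow> list_computable_in A (\<lambda>x. tl (F x))"
  unfolding list_computable_in_def psnd_list_encode[symmetric]
  by (intro computable_in_psnd computable_in_diff computable_in_const)

lemma list_computable_in_Cons [comp_intros]:
  "computable_in A f \<Longrightarrow> list_computable_in A F \<Longrightarrow> list_computable_in A (\<lambda>x. f x # F x)"
  unfolding list_computable_in_def list_encode.simps
  by (intro computable_in_Suc computable_in_pair)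

lemma list_computable_in_if [comp_intros]:
  "decidable_in A P \<Longrightarrow> list_computable_in A F \<Longrightarrow> list_computable_in A G \<Longrightarrow>
    list_computable_in A (\<lambda>x. if P x then F x else G x)"
  unfolding list_computable_in_def if_distrib[of list_encode] by (rule computable_in_if)

lemma list_computable_in_rec:
  assumes "list_computable_in A F" "computable_in A b"
    "list_computable_in A (\<lambda>p. s (pfst p) (list_decode (pfst (psnd p))) (psnd (psnd p)))"
  shows "list_computable_in A (\<lambda>x. rec_nat (F x) (\<lambda>n r. s n r x) (b x))"
proof -
  have "list_encode (rec_nat (F x) (\<lambda>n r. s n r x) m) =
      rec_nat (list_encode (F x)) (\<lambda>n r. list_encode (s n (list_decode r) x)) m" for x m
  proof (induction m)
    case (Suc m)
    show ?case by (simp add: Suc[symmetric])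
  qed simp
  then show ?thesis
    using assms unfolding list_computable_in_def by (auto intro: computable_in_rec)
qed

lemma list_computable_in_drop [comp_intros]:
  assumes "computable_in A f" "list_computable_in A F"
  shows "list_computable_in A (\<lambda>x. drop (f x) (F x))"
proof -
  have "drop m xs = rec_nat xs (\<lambda>n r. tl r) m" for m and xs :: "nat list"
    by (induction m) (auto simp: drop_Suc tl_drop[symmetric])
  then show ?thesis
    by (simp only:) (intro list_computable_in_rec assms comp_intros)
qed

lemma computable_in_hd0 [comp_intros]:
  "list_computable_in A F \<Longrightarrow> computable_in A (\<lambda>x. hd0 (F x))"
  unfolding pfst_list_encode[symmetric] by (intro comp_intros)

lemma computable_in_nth0 [comp_intros]:
  "list_computable_in A F \<Longrightarrow> computable_in A f \<Longrightarrow> computable_in A (\<lambda>x. nth0 (F x) (f x))"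
  unfolding hd0_drop[symmetric] by (intro comp_intros)

lemma computable_in_length [comp_intros]:
  assumes "list_computable_in A F"
  shows "computable_in A (\<lambda>x. length (F x))"
proof -
  have "computable_in A (\<lambda>x. LEAST i. list_encode (drop i (F x)) = 0)"
    by (rule computable_in_Least, intro comp_intros list_computable_in_comp[OF assms])
      (auto intro: exI[of _ "length (F _)"])
  moreover have "(LEAST i. list_encode (drop i xs) = 0) = length xs" for xs
    by (rule Least_equality) auto
  ultimately show ?thesis by simp
qed

lemma list_computable_in_map_upt [comp_intros]:
  assumes L: "computable_in A L" and E: "computable_in A (\<lambda>p. E (pfst p) (psnd p))"
  shows "list_computable_in A (\<lambda>x. map (\<lambda>i. E i x) [0..<L x])"
proof -
  have E': "computable_in A f \<Longrightarrow> computable_in A g \<Longrightarrow> computable_in A (\<lambda>x. E (f x) (g x))" for f g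
    by (rule computable_in_apply2[OF E])
  \<comment> \<open>The list is built from its end, since only \<open>Cons\<close> is known to be
    computable so far; \<open>append\<close> is derived from this lemma afterwards.\<close>
  have *: "rec_nat [] (\<lambda>m r. E (L x - Suc m) x # r) k = map (\<lambda>i. E i x) [L x - k..<L x]"
    if "k \<le> L x" for x k
    using that
  proof (induction k)
    case (Suc k)
    then have "[L x - Suc k..<L x] = (L x - Suc k) # [L x - k..<L x]"
      using upt_conv_Cons[of "L x - Suc k" "L x"] Suc_diff_Suc[of k "L x"] by simp
    with Suc show ?case by simp
  qed simp
  have "list_computable_in A (\<lambda>x. rec_nat [] (\<lambda>m r. E (L x - Suc m) x # r) (L x))"
    by (rule list_computable_in_rec) (intro comp_intros E' L computable_in_comp[OF L])+
  then show ?thesis using * by simp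
qed

lemma map_nth0: "map (\<lambda>i. f (nth0 xs i)) [0..<length xs] = map f xs"
  by (rule nth_equalityI) auto

lemma list_computable_in_append [comp_intros]:
  assumes "list_computable_in A F" "list_computable_in A G"
  shows "list_computable_in A (\<lambda>x. F x @ G x)"
proof -
  have "xs @ ys = map (\<lambda>i. if i < length xs then nth0 xs i else nth0 ys (i - length xs))
      [0..<length xs + length ys]" for xs ys
    by (rule nth_equalityI) (auto simp: nth_append)
  then show ?thesis
    by (simp only:) (intro comp_intros assms list_computable_in_comp[OF assms(1)]
        list_computable_in_comp[OF assms(2)])
qed

lemma list_computable_in_take [comp_intros]:
  assumes "computable_in A f" "list_computable_in A F"
  shows "list_computable_in A (\<lambda>x. take (f x) (F x))"
proof -
  have "take m xs = map (nth0 xs) [0..<if m \<le> length xs then m else length xs]" for m xs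
    by (rule nth_equalityI) auto
  then show ?thesis
    by (simp only:) (intro comp_intros assms list_computable_in_comp[OF assms(2)])
qed

lemma list_computable_in_map [comp_intros]:
  assumes F: "list_computable_in A F" and E: "computable_in A (\<lambda>p. E (pfst p) (psnd p))"
  shows "list_computable_in A (\<lambda>x. map (\<lambda>y. E y x) (F x))"
proof -
  have "list_computable_in A (\<lambda>x. map (\<lambda>i. E (nth0 (F x) i) x) [0..<length (F x)])"
    by (intro comp_intros F list_computable_in_comp[OF F] computable_in_apply2[OF E])
  then show ?thesis by (simp only: map_nth0[of "\<lambda>y. E y _"])
qed

lemma list_computable_in_filter [comp_intros]:
  assumes F: "list_computable_in A F" and P: "decidable_in A (\<lambda>p. P (pfst p) (psnd p))"
  shows "list_computable_in A (\<lambda>x. filter (\<lambda>y. P y x) (F x))"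
proof -
  have *: "rec_nat [] (\<lambda>i r. if P (nth0 (F x) i) x then r @ [nth0 (F x) i] else r) k =
      filter (\<lambda>y. P y x) (take k (F x))" if "k \<le> length (F x)" for x k
    using that by (induction k) (auto simp: take_Suc_conv_app_nth)
  have "list_computable_in A (\<lambda>x. rec_nat []
      (\<lambda>i r. if P (nth0 (F x) i) x then r @ [nth0 (F x) i] else r) (length (F x)))"
    by (rule list_computable_in_rec)
      (intro comp_intros F list_computable_in_comp[OF F] decidable_in_comp2[OF P])+
  then show ?thesis using * by simp
qed

lemma decidable_in_list_eq [comp_intros]:
  "list_computable_in A F \<Longrightarrow> list_computable_in A G \<Longrightarrow> decidable_in A (\<lambda>x. F x = G x)"
  unfolding list_encode_eq_iff[symmetric] by (intro decidable_in_eq comp_intros)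

lemma decidable_in_ball [comp_intros]:
  assumes F: "list_computable_in A F" and P: "decidable_in A (\<lambda>p. P (pfst p) (psnd p))"
  shows "decidable_in A (\<lambda>x. \<forall>y\<in>set (F x). P y x)"
proof -
  have "(\<forall>y\<in>set (F x). P y x) \<longleftrightarrow> (\<forall>i<length (F x). P (nth0 (F x) i) x)" for x
    using nth_mem[of _ "F x"] by (auto simp: in_set_conv_nth)
  then show ?thesis
    by (simp only:)
      (intro comp_intros F list_computable_in_comp[OF F] decidable_in_comp2[OF P])
qed

lemma decidable_in_bex [comp_intros]:
  assumes F: "list_computable_in A F" and P: "decidable_in A (\<lambda>p. P (pfst p) (psnd p))"
  shows "decidable_in A (\<lambda>x. \<exists>y\<in>set (F x). P y x)"
  using decidable_in_not[OF decidable_in_ball[OF F decidable_in_not[OF P]]] by simp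

lemma decidable_in_member [comp_intros]:
  assumes f: "computable_in A f" and F: "list_computable_in A F"
  shows "decidable_in A (\<lambda>x. f x \<in> set (F x))"
proof -
  have "decidable_in A (\<lambda>x. \<exists>y\<in>set (F x). y = f x)"
    by (intro comp_intros F computable_in_comp[OF f])
  then show ?thesis by simp
qed

section \<open>Halting computations witnessed by finite derivations\<close>

lemma reval_deterministic: "reval A f xs y \<Longrightarrow> reval A f xs z \<Longrightarrow> y = z"
proof (induction arbitrary: z rule: reval.induct)
  case (zero xs)
  then show ?case by (auto elim: reval.cases)
next
  case (succ x xs)
  then show ?case by (auto elim: reval.cases)
next
  case (proj i xs)
  from proj.prems show ?case by (auto elim: reval.cases)
next
  case (orc x xs)
  then show ?case by (auto elim: reval.cases)
next
  case (comp ys gs xs f y)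
  from comp.prems obtain zs where zs: "length zs = length gs"
    "\<forall>i<length gs. reval A (gs ! i) xs (zs ! i)" "reval A f zs z"
    by (cases rule: reval.cases) auto
  have "ys = zs" using comp.hyps comp.IH zs by (intro nth_equalityI) auto
  then show ?case using comp.IH zs by auto
next
  case (prim0 f xs y g)
  from prim0.prems show ?case by (cases rule: reval.cases) (auto intro: prim0.IH)
next
  case (primS f g n xs y w)
  from primS.prems obtain y' where "reval A (Prim f g) (n # xs) y'" "reval A g (y' # n # xs) z"
    by (cases rule: reval.cases) auto
  then show ?case using primS.IH by metis
next
  case (mu f n xs)
  from mu.prems have z: "reval A f (z # xs) 0" "\<forall>m<z. \<exists>y. 0 < y \<and> reval A f (m # xs) y"
    by (cases rule: reval.cases; auto)+
  show ?case
  proof (rule linorder_cases[of n z])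
    assume "n < z"
    then show ?thesis using z mu.IH by (metis less_irrefl)
  next
    assume "z < n"
    then show ?thesis using z mu.IH by (metis less_irrefl)
  qed
qed

lemma inj_enc: "enc f = enc g \<Longrightarrow> f = g"
proof (induction f arbitrary: g)
  case (Comp f gs)
  from Comp.prems obtain f' gs' where g: "g = Comp f' gs'" "enc f = enc f'" "map enc gs = map enc gs'"
    by (cases g) auto
  have "gs = gs'"
  proof (rule nth_equalityI)
    show l: "length gs = length gs'" using g(3) map_eq_imp_length_eq by blast
    show "gs ! i = gs' ! i" if "i < length gs" for i
      using that l g(3) Comp.IH(2)[of "gs ! i" "gs' ! i"] by (metis nth_map nth_mem)
  qed
  then show ?case using g Comp.IH(1) by simp
next
  case (Prim f1 f2)
  then show ?case by (cases g) auto
next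
  case (Mu f)
  then show ?case by (cases g) auto
qed (case_tac g; simp)+

primrec subst_oracle :: "recf \<Rightarrow> recf \<Rightarrow> recf" where
  "subst_oracle h Zero = Zero"
| "subst_oracle h Succ = Succ"
| "subst_oracle h (Proj i) = Proj i"
| "subst_oracle h Orc = Comp h [Proj 0]"
| "subst_oracle h (Comp f gs) = Comp (subst_oracle h f) (map (subst_oracle h) gs)"
| "subst_oracle h (Prim f g) = Prim (subst_oracle h f) (subst_oracle h g)"
| "subst_oracle h (Mu f) = Mu (subst_oracle h f)"

lemma reval_subst_oracle:
  assumes h: "\<And>x. reval A h [x] (B x)"
  shows "reval B f xs y \<Longrightarrow> reval A (subst_oracle h f) xs y"
proof (induction rule: reval.induct)
  case (orc x xs)
  have "reval A (Proj 0) (x # xs) x" using reval.proj[of 0 "x # xs"] by simp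
  then show ?case by (auto intro!: reval.comp[where ys="[x]"] h)
next
  case (comp ys gs xs f z)
  then show ?case by (auto intro!: reval.comp[where ys=ys])
next
  case (mu f n xs)
  then show ?case by (auto intro!: reval.mu)
qed (auto intro: reval.intros)

lemma computable_in_trans:
  assumes "computable_in A B" "computable_in B g"
  shows "computable_in A g"
  using assms reval_subst_oracle unfolding computable_in_def by meson

text \<open>
  Judgements, coded as numbers: \<open>wf_j c\<close> says that \<open>c\<close> is the code of a program, and
  \<open>ev_j c l y\<close> that program \<open>c\<close> with arguments \<open>l\<close> yields \<open>y\<close>. The former are needed because
  an evaluation need not visit every subprogram, so it does not certify that \<open>c\<close> is a code.
  A derivation is a list of judgements each of which follows from earlier ones, which is
  decidable by bounded quantification, without a universal program.
\<close>

definition wf_j :: "nat \<Rightarrow> nat" where "wf_j c = prod_encode (c, 0)"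

definition ev_j :: "nat \<Rightarrow> nat list \<Rightarrow> nat \<Rightarrow> nat" where
  "ev_j c l y = prod_encode (c, Suc (prod_encode (list_encode l, y)))"

text \<open>Evaluation judgements have a positive second component, which tells them apart from
  \<open>wf_j\<close>; \<open>- 1\<close> strips that \<open>Suc\<close>.\<close>

definition j_args :: "nat \<Rightarrow> nat list" where "j_args p = list_decode (pfst (psnd p - 1))"

definition j_val :: "nat \<Rightarrow> nat" where "j_val p = psnd (psnd p - 1)"

lemma judgement_simps [simp]:
  "pfst (ev_j c l y) = c" "j_args (ev_j c l y) = l" "j_val (ev_j c l y) = y"
  "0 < psnd (ev_j c l y)" "pfst (wf_j c) = c" "psnd (wf_j c) = 0"
  by (simp_all add: ev_j_def wf_j_def j_args_def j_val_def)

definition wf_rule :: "nat \<Rightarrow> nat list \<Rightarrow> bool" where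
  "wf_rule c S \<longleftrightarrow>
    (pfst c = 0 \<or> pfst c = 1 \<or> pfst c = 3) \<and> psnd c = 0 \<or>
    pfst c = 2 \<or>
    pfst c = 4 \<and> wf_j (pfst (psnd c)) \<in> set S \<and>
      (\<forall>g\<in>set (list_decode (psnd (psnd c))). wf_j g \<in> set S) \<or>
    pfst c = 5 \<and> wf_j (pfst (psnd c)) \<in> set S \<and> wf_j (psnd (psnd c)) \<in> set S \<or>
    pfst c = 6 \<and> wf_j (psnd c) \<in> set S"

text \<open>One disjunct per clause of \<open>reval\<close>, with the tags of \<open>enc\<close>.
  Intermediate values are read off judgements \<open>p\<close> already in \<open>S\<close>, so that
  every quantifier is bounded, and an oracle query must fall inside \<open>\<sigma>\<close>.\<close>

definition ev_rule :: "nat list \<Rightarrow> nat \<Rightarrow> nat list \<Rightarrow> nat \<Rightarrow> nat list \<Rightarrow> bool" where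
  "ev_rule \<sigma> c l y S \<longleftrightarrow>
    pfst c = 0 \<and> psnd c = 0 \<and> y = 0 \<or>
    pfst c = 1 \<and> psnd c = 0 \<and> l \<noteq> [] \<and> y = Suc (hd0 l) \<or>
    pfst c = 2 \<and> psnd c < length l \<and> y = nth0 l (psnd c) \<or>
    pfst c = 3 \<and> psnd c = 0 \<and> l \<noteq> [] \<and> hd0 l < length \<sigma> \<and> y = nth0 \<sigma> (hd0 l) \<or>
    pfst c = 4 \<and> (\<exists>p\<in>set S. p = ev_j (pfst (psnd c)) (j_args p) y \<and>
      length (j_args p) = length (list_decode (psnd (psnd c))) \<and>
      (\<forall>i<length (list_decode (psnd (psnd c))).
        ev_j (nth0 (list_decode (psnd (psnd c))) i) l (nth0 (j_args p) i) \<in> set S)) \<or>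
    pfst c = 5 \<and> l \<noteq> [] \<and> hd0 l = 0 \<and> ev_j (pfst (psnd c)) (tl l) y \<in> set S \<or>
    pfst c = 5 \<and> l \<noteq> [] \<and> 0 < hd0 l \<and> (\<exists>p\<in>set S.
      ev_j c ((hd0 l - 1) # tl l) (j_val p) \<in> set S \<and>
      ev_j (psnd (psnd c)) (j_val p # (hd0 l - 1) # tl l) y \<in> set S) \<or>
    pfst c = 6 \<and> ev_j (psnd c) (y # l) 0 \<in> set S \<and>
      (\<forall>m<y. \<exists>p\<in>set S. 0 < j_val p \<and> ev_j (psnd c) (m # l) (j_val p) \<in> set S)"

definition j_rule :: "nat list \<Rightarrow> nat list \<Rightarrow> nat \<Rightarrow> bool" where
  "j_rule \<sigma> S j \<longleftrightarrow> psnd j = 0 \<and> wf_rule (pfst j) S \<or>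
    0 < psnd j \<and> ev_rule \<sigma> (pfst j) (j_args j) (j_val j) S"

definition derivation :: "nat list \<Rightarrow> nat list \<Rightarrow> bool" where
  "derivation \<sigma> D \<longleftrightarrow> (\<forall>i<length D. j_rule \<sigma> (take i D) (nth0 D i))"

text \<open>
  \<open>\<sigma>\<close> is a finite initial segment of the oracle; its length also bounds the search, which makes
  \<open>halts\<close> both decidable and monotone in \<open>\<sigma>\<close>.
\<close>

definition halts :: "nat \<Rightarrow> nat list \<Rightarrow> bool" where
  "halts e \<sigma> \<longleftrightarrow> (\<exists>d<length \<sigma>. derivation \<sigma> (list_decode d) \<and> wf_j e \<in> set (list_decode d) \<and>
    (\<exists>p\<in>set (list_decode d). p = ev_j e [e] (j_val p)))"

lemma decidable_in_halts [comp_intros]: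
  assumes e: "computable_in A e" and s: "list_computable_in A s"
  shows "decidable_in A (\<lambda>x. halts (e x) (s x))"
  unfolding halts_def derivation_def j_rule_def wf_rule_def ev_rule_def wf_j_def ev_j_def j_args_def
    j_val_def
  by (intro comp_intros e s computable_in_comp[OF e] list_computable_in_comp[OF s])

lemma wf_rule_mono: "wf_rule c S \<Longrightarrow> set S \<subseteq> set T \<Longrightarrow> wf_rule c T"
  unfolding wf_rule_def by blast

lemma ev_rule_mono:
  assumes "ev_rule \<sigma> c l y S" "set S \<subseteq> set T"
  shows "ev_rule (\<sigma> @ \<tau>) c l y T"
proof -
  have "i < length (\<sigma> @ \<tau>) \<and> y = nth0 (\<sigma> @ \<tau>) i" if "i < length \<sigma>" "y = nth0 \<sigma> i" for i y
    using that by (simp add: nth_append)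
  then show ?thesis using assms unfolding ev_rule_def by (elim disjE) (simp; blast)+
qed

lemma j_rule_mono: "j_rule \<sigma> S j \<Longrightarrow> set S \<subseteq> set T \<Longrightarrow> j_rule (\<sigma> @ \<tau>) T j"
  unfolding j_rule_def using wf_rule_mono ev_rule_mono by blast

lemma derivation_mono: "derivation \<sigma> D \<Longrightarrow> derivation (\<sigma> @ \<tau>) D"
  unfolding derivation_def using j_rule_mono by blast

lemma halts_mono: "halts e \<sigma> \<Longrightarrow> halts e (\<sigma> @ \<tau>)"
  unfolding halts_def using derivation_mono by (metis length_append trans_less_add1)

lemma derivation_append:
  assumes "derivation \<sigma> D" "derivation \<sigma> E"
  shows "derivation \<sigma> (D @ E)"
  unfolding derivation_def
proof (intro allI impI)
  fix i assume i: "i < length (D @ E)"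
  show "j_rule \<sigma> (take i (D @ E)) (nth0 (D @ E) i)"
  proof (cases "i < length D")
    case True
    then show ?thesis using assms(1) by (simp add: derivation_def nth0_def nth_append)
  next
    case False
    then have "j_rule \<sigma> (take (i - length D) E) (nth0 (D @ E) i)"
      using assms(2) i by (simp add: derivation_def nth0_def nth_append)
    from j_rule_mono[OF this, of "take i (D @ E)" "[]"] False show ?thesis by simp
  qed
qed

section \<open>Completeness and soundness of derivations\<close>

definition derivable :: "(nat \<Rightarrow> nat) \<Rightarrow> nat \<Rightarrow> bool" where
  "derivable A j \<longleftrightarrow> (\<exists>m D. derivation (map A [0..<m]) D \<and> j \<in> set D)"

lemma map_upt_append: "m \<le> n \<Longrightarrow> map A [0..<n] = map A [0..<m] @ map A [m..<n]"
  using upt_add_eq_append[of 0 m "n - m"] by simp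

lemma derivation_le:
  "derivation (map A [0..<m]) D \<Longrightarrow> m \<le> n \<Longrightarrow> derivation (map A [0..<n]) D"
  using derivation_mono by (metis map_upt_append)

text \<open>Derivations can be concatenated, and the longest of the oracle segments serves them all
  by monotonicity.\<close>

lemma derivable_collect:
  "\<forall>p\<in>set S. derivable A p \<Longrightarrow> \<exists>m D. derivation (map A [0..<m]) D \<and> set S \<subseteq> set D"
proof (induction S)
  case Nil
  have "derivation (map A [0..<0]) []" by (simp add: derivation_def)
  then show ?case by (metis empty_subsetI list.set(1))
next
  case (Cons p S)
  then obtain m D where D: "derivation (map A [0..<m]) D" "set S \<subseteq> set D" by auto
  from Cons.prems obtain m' E where E: "derivation (map A [0..<m']) E" "p \<in> set E"
    by (auto simp: derivable_def)
  have "derivation (map A [0..<max m m']) (D @ E)"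
    using derivation_le[OF D(1), of "max m m'"] derivation_le[OF E(1), of "max m m'"]
    by (intro derivation_append) simp_all
  moreover have "set (p # S) \<subseteq> set (D @ E)" using D E by auto
  ultimately show ?case by blast
qed

lemma derivable_rule:
  assumes "\<forall>p\<in>set S. derivable A p" "j_rule (map A [0..<k]) S j"
  shows "derivable A j"
proof -
  obtain m D where D: "derivation (map A [0..<m]) D" "set S \<subseteq> set D"
    using derivable_collect[OF assms(1)] by blast
  let ?n = "max m k"
  have "j_rule (map A [0..<?n]) D j"
    using j_rule_mono[OF assms(2) D(2), of "map A [k..<?n]"] map_upt_append[of k ?n A] by simp
  moreover have "derivation (map A [0..<?n]) D" using derivation_le[OF D(1)] by simp
  ultimately have "derivation (map A [0..<?n]) (D @ [j])"
    by (auto simp: derivation_def nth0_def nth_append less_Suc_eq)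
  then show ?thesis unfolding derivable_def by (metis in_set_conv_decomp)
qed

lemma derivable_wf: "derivable A (wf_j (enc f))"
proof (induction f)
  case (Comp f gs)
  then show ?case
    by (intro derivable_rule[where S="wf_j (enc f) # map (\<lambda>g. wf_j (enc g)) gs" and k=0])
      (auto simp: j_rule_def wf_rule_def)
next
  case (Prim f g)
  then show ?case
    by (intro derivable_rule[where S="[wf_j (enc f), wf_j (enc g)]" and k=0])
      (auto simp: j_rule_def wf_rule_def)
next
  case (Mu f)
  then show ?case
    by (intro derivable_rule[where S="[wf_j (enc f)]" and k=0])
      (auto simp: j_rule_def wf_rule_def)
qed (rule derivable_rule[where S="[]" and k=0]; simp add: j_rule_def wf_rule_def)+

lemma derivable_ev_j_rule:
  assumes "\<forall>p\<in>set S. derivable A p" "ev_rule (map A [0..<k]) c l y S"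
  shows "derivable A (ev_j c l y)"
  using assms by (intro derivable_rule[where S=S and k=k]) (auto simp: j_rule_def)

lemma derivable_eval: "reval A f xs y \<Longrightarrow> derivable A (ev_j (enc f) xs y)"
proof (induction rule: reval.induct)
  case (zero xs)
  show ?case by (rule derivable_ev_j_rule[where S="[]" and k=0]) (auto simp: ev_rule_def)
next
  case (succ x xs)
  show ?case by (rule derivable_ev_j_rule[where S="[]" and k=0]) (auto simp: ev_rule_def hd0_def)
next
  case (proj i xs)
  then show ?case by (intro derivable_ev_j_rule[where S="[]" and k=0]) (auto simp: ev_rule_def)
next
  case (orc x xs)
  show ?case
    by (rule derivable_ev_j_rule[where S="[]" and k="Suc x"])
      (auto simp: ev_rule_def hd0_def nth_append)
next
  case (comp ys gs xs f z)
  have "ev_rule (map A [0..<0]) (enc (Comp f gs)) xs z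
      (ev_j (enc f) ys z # map (\<lambda>i. ev_j (enc (gs ! i)) xs (ys ! i)) [0..<length gs])"
    using comp.hyps by (auto simp: ev_rule_def)
  from derivable_ev_j_rule[OF _ this] show ?case using comp by auto
next
  case (prim0 f xs y g)
  then show ?case
    by (intro derivable_ev_j_rule[where S="[ev_j (enc f) xs y]" and k=0])
      (auto simp: ev_rule_def hd0_def)
next
  case (primS f g n xs y z)
  then show ?case
    by (intro derivable_ev_j_rule[where k=0 and
          S="[ev_j (enc (Prim f g)) (n # xs) y, ev_j (enc g) (y # n # xs) z]"])
      (auto simp: ev_rule_def hd0_def)
next
  case (mu f n xs)
  then obtain Y where Y: "\<forall>m<n. 0 < Y m \<and> derivable A (ev_j (enc f) (m # xs) (Y m))"
    by metis
  let ?S = "ev_j (enc f) (n # xs) 0 # map (\<lambda>m. ev_j (enc f) (m # xs) (Y m)) [0..<n]"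
  have "\<exists>p\<in>set ?S. 0 < j_val p \<and> ev_j (enc f) (m # xs) (j_val p) \<in> set ?S" if "m < n" for m
  proof (rule bexI)
    show *: "ev_j (enc f) (m # xs) (Y m) \<in> set ?S" using that by auto
    show "0 < j_val (ev_j (enc f) (m # xs) (Y m)) \<and>
        ev_j (enc f) (m # xs) (j_val (ev_j (enc f) (m # xs) (Y m))) \<in> set ?S"
      unfolding judgement_simps using that Y * by blast
  qed
  moreover have "pfst (enc (Mu f)) = 6" "psnd (enc (Mu f)) = enc f"
    "ev_j (enc f) (n # xs) 0 \<in> set ?S" by simp_all
  ultimately have "ev_rule (map A [0..<0]) (enc (Mu f)) xs n ?S"
    unfolding ev_rule_def by presburger
  from derivable_ev_j_rule[OF _ this] show ?case using mu Y by auto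
qed

text \<open>An evaluation judgement whose first component codes no program is vacuously true, so
  soundness needs no side condition; \<open>halts\<close> rules this case out by asking for
  \<open>wf_j e\<close> as well.\<close>

definition j_true :: "(nat \<Rightarrow> nat) \<Rightarrow> nat \<Rightarrow> bool" where
  "j_true A j \<longleftrightarrow> (\<forall>c. j = wf_j c \<longrightarrow> (\<exists>f. enc f = c)) \<and>
    (\<forall>f l y. j = ev_j (enc f) l y \<longrightarrow> reval A f l y)"

lemma wf_rule_sound:
  assumes r: "wf_rule c S" and S: "\<And>c. wf_j c \<in> set S \<Longrightarrow> \<exists>f. enc f = c"
  shows "\<exists>f. enc f = c"
proof -
  have c: "c = prod_encode (pfst c, psnd c)" by simp
  from r consider
      "pfst c = 0" "psnd c = 0" | "pfst c = 1" "psnd c = 0" | "pfst c = 3" "psnd c = 0" | "pfst c = 2"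
    | "pfst c = 4" "wf_j (pfst (psnd c)) \<in> set S" "\<forall>g\<in>set (list_decode (psnd (psnd c))). wf_j g \<in> set S"
    | "pfst c = 5" "wf_j (pfst (psnd c)) \<in> set S" "wf_j (psnd (psnd c)) \<in> set S"
    | "pfst c = 6" "wf_j (psnd c) \<in> set S"
    unfolding wf_rule_def by (elim disjE conjE; blast)
  then show ?thesis
  proof cases
    case 1
    then show ?thesis using c by (metis enc.simps(1))
  next
    case 2
    then show ?thesis using c by (metis enc.simps(2))
  next
    case 3
    then show ?thesis using c by (metis enc.simps(4))
  next
    case 4
    then show ?thesis using c by (metis enc.simps(3))
  next
    case 5
    have "\<forall>g\<in>set (list_decode (psnd (psnd c))). \<exists>f. g = enc f" using 5(3) S by metis
    then obtain fs where fs: "list_decode (psnd (psnd c)) = map enc fs"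
      unfolding ex_map_conv[symmetric] by blast
    obtain f where "enc f = pfst (psnd c)" using S 5 by blast
    then have "enc (Comp f fs) = c"
      using 5(1) by (simp add: fs[symmetric]) (metis c)
    then show ?thesis by blast
  next
    case 6
    obtain f g where "enc f = pfst (psnd c)" "enc g = psnd (psnd c)" using S 6 by blast
    then have "enc (Prim f g) = c" using 6(1) by simp (metis c)
    then show ?thesis by blast
  next
    case 7
    obtain f where "enc f = psnd c" using S 7 by blast
    then have "enc (Mu f) = c" using 7(1) by simp (metis c)
    then show ?thesis by blast
  qed
qed

lemma hd0_Cons [simp]: "hd0 (x # xs) = x"
  by (simp add: hd0_def)

lemma ev_rule_sound:
  assumes r: "ev_rule (map A [0..<m]) (enc f) l y S"
    and S: "\<And>f l y. ev_j (enc f) l y \<in> set S \<Longrightarrow> reval A f l y"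
  shows "reval A f l y"
proof (cases f)
  case Zero
  with r show ?thesis by (auto simp: ev_rule_def intro: reval.intros)
next
  case Succ
  with r show ?thesis by (cases l) (auto simp: ev_rule_def intro: reval.intros)
next
  case (Proj i)
  with r show ?thesis by (auto simp: ev_rule_def intro: reval.intros)
next
  case Orc
  with r show ?thesis by (cases l) (auto simp: ev_rule_def intro: reval.intros)
next
  case (Comp h gs)
  with r obtain p where "p \<in> set S" "p = ev_j (enc h) (j_args p) y" "length (j_args p) = length gs"
    "\<forall>i<length gs. ev_j (enc (gs ! i)) l (j_args p ! i) \<in> set S"
    by (auto simp: ev_rule_def)
  then obtain ys where "ev_j (enc h) ys y \<in> set S" "length ys = length gs"
    "\<forall>i<length gs. ev_j (enc (gs ! i)) l (ys ! i) \<in> set S"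
    by metis
  then show ?thesis unfolding Comp by (intro reval.comp[where ys=ys]) (auto intro: S)
next
  case (Prim g h)
  with r obtain x xs where l: "l = x # xs" by (cases l) (auto simp: ev_rule_def)
  show ?thesis
  proof (cases x)
    case 0
    with r l Prim have "ev_j (enc g) xs y \<in> set S" by (auto simp: ev_rule_def)
    then show ?thesis using l 0 Prim by (auto intro: reval.prim0 S)
  next
    case (Suc n)
    with r l Prim obtain z where "ev_j (enc (Prim g h)) (n # xs) z \<in> set S"
      "ev_j (enc h) (z # n # xs) y \<in> set S"
      by (auto simp: ev_rule_def)
    then show ?thesis unfolding Prim l Suc by (auto intro: reval.primS S simp del: enc.simps)
  qed
next
  case (Mu g)
  with r have "ev_j (enc g) (y # l) 0 \<in> set S"
    "\<forall>m<y. \<exists>z. 0 < z \<and> ev_j (enc g) (m # l) z \<in> set S"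
    by (auto simp: ev_rule_def)
  then show ?thesis unfolding Mu by (intro reval.mu) (auto intro: S)
qed

lemma j_rule_sound:
  assumes r: "j_rule (map A [0..<m]) S j" and S: "\<forall>p\<in>set S. j_true A p"
  shows "j_true A j"
proof -
  have "\<exists>f. enc f = c" if "j = wf_j c" for c
    using wf_rule_sound[of c S] S r that by (auto simp: j_true_def j_rule_def)
  moreover have "reval A f l y" if "j = ev_j (enc f) l y" for f l y
  proof -
    have "0 < psnd j" "pfst j = enc f" "j_args j = l" "j_val j = y" using that by simp_all
    then have "ev_rule (map A [0..<m]) (enc f) l y S" using r by (simp add: j_rule_def)
    then show ?thesis by (rule ev_rule_sound) (use S in \<open>auto simp: j_true_def\<close>)
  qed
  ultimately show ?thesis by (simp add: j_true_def)
qed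

lemma derivation_sound:
  assumes "derivation (map A [0..<m]) D"
  shows "\<forall>j\<in>set D. j_true A j"
proof -
  have "j_true A (D ! i)" if "i < length D" for i
    using that
  proof (induction i rule: less_induct)
    case (less i)
    have "j_rule (map A [0..<m]) (take i D) (D ! i)"
      using assms less.prems by (auto simp: derivation_def)
    then show ?case
      by (rule j_rule_sound) (use less in \<open>auto simp: in_set_conv_nth\<close>)
  qed
  then show ?thesis by (auto simp: in_set_conv_nth)
qed

lemma jump_iff_halts: "e \<in> jump A \<longleftrightarrow> (\<exists>m. halts e (map A [0..<m]))"
proof
  assume "e \<in> jump A"
  then obtain f y where f: "enc f = e" "reval A f [e] y" by (auto simp: jump_def)
  have "\<forall>p\<in>set [wf_j e, ev_j e [e] y]. derivable A p"
    using derivable_wf derivable_eval[OF f(2)] f(1) by auto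
  from derivable_collect[OF this] obtain m D where
    D: "derivation (map A [0..<m]) D" "wf_j e \<in> set D" "ev_j e [e] y \<in> set D" by auto
  \<comment> \<open>The segment has to answer the queries made in \<open>D\<close> and also to be
    longer than the code of \<open>D\<close>, because its length bounds the search.\<close>
  have "halts e (map A [0..<max m (Suc (list_encode D))])"
    unfolding halts_def
    by (rule exI[of _ "list_encode D"]) (use D in \<open>auto intro: derivation_le bexI[of _ "ev_j e [e] y"]\<close>)
  then show "\<exists>m. halts e (map A [0..<m])" by blast
next
  assume "\<exists>m. halts e (map A [0..<m])"
  then obtain m D y where D: "derivation (map A [0..<m]) D" "wf_j e \<in> set D" "ev_j e [e] y \<in> set D"
    unfolding halts_def by metis
  obtain f where "enc f = e" using derivation_sound[OF D(1)] D(2) unfolding j_true_def by blast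
  moreover from this have "reval A f [e] y"
    using derivation_sound[OF D(1)] D(3) unfolding j_true_def by blast
  ultimately show "e \<in> jump A" unfolding jump_def by blast
qed

section \<open>Jumps and limits\<close>

primrec const_prog :: "nat \<Rightarrow> recf" where
  "const_prog 0 = Zero"
| "const_prog (Suc n) = Comp Succ [const_prog n]"

lemma reval_const_prog: "reval A (const_prog n) xs n"
proof (induction n)
  case (Suc n)
  then show ?case
    using reval.comp[of "[n]" "[const_prog n]" A xs Succ "Suc n"] by (simp add: reval.succ)
qed (simp add: reval.zero)

text \<open>The jump runs a program on its own code. Hard-wiring \<open>x\<close> by
  \<open>const_prog\<close> makes the program ignore that input, so halting on it is the same as
  success of the search for \<open>x\<close>.\<close>

lemma reval_search_iff:
  assumes h: "\<And>m. reval A h [m, x] (if P m then 0 else 1)"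
  shows "(\<exists>y. reval A (Comp (Mu h) [const_prog x]) xs y) \<longleftrightarrow> (\<exists>m. P m)"
proof
  assume "\<exists>y. reval A (Comp (Mu h) [const_prog x]) xs y"
  then obtain y z where z: "reval A (const_prog x) xs z" and y: "reval A (Mu h) [z] y"
    by (auto elim!: reval.cases[of A "Comp _ _"] simp: length_Suc_conv)
  have "z = x" by (rule reval_deterministic[OF z reval_const_prog])
  with y have "reval A h [y, x] 0" by (auto elim: reval.cases)
  from reval_deterministic[OF this h] have "P y" by (simp split: if_splits)
  then show "\<exists>m. P m" ..
next
  assume P: "\<exists>m. P m"
  define n where "n = (LEAST m. P m)"
  have "reval A h [n, x] 0" using h[of n] LeastI_ex[OF P] by (simp add: n_def)
  moreover have "\<exists>y. 0 < y \<and> reval A h [m, x] y" if "m < n" for m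
    using h[of m] not_less_Least[of m P] that by (auto simp: n_def)
  ultimately have "reval A (Mu h) [x] n" by (intro reval.mu) auto
  then have "reval A (Comp (Mu h) [const_prog x]) xs n"
    by (intro reval.comp[where ys="[x]"]) (auto intro: reval_const_prog)
  then show "\<exists>y. reval A (Comp (Mu h) [const_prog x]) xs y" ..
qed

lemma computable_in_enc_const_prog [comp_intros]:
  assumes "computable_in A f"
  shows "computable_in A (\<lambda>x. enc (const_prog (f x)))"
proof -
  have "enc (const_prog n) =
      rec_nat (enc Zero) (\<lambda>n r. prod_encode (4, prod_encode (enc Succ, list_encode [r]))) n" for n
    by (induction n) auto
  then show ?thesis by (simp only:) (intro computable_in_rec assms comp_intros)
qed

lemma decidable_in_jump_ex:
  assumes "decidable_in A (\<lambda>p. P (pfst p) (psnd p))"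
  shows "decidable_in (chi (jump A)) (\<lambda>x. \<exists>m. P x m)"
proof -
  have "computable_in A (\<lambda>p. if P (pfst p) (psnd p) then 0 else 1)"
    by (intro comp_intros assms)
  moreover have "ncomp A 2 (\<lambda>xs. prod_encode (xs ! 1, xs ! 0))"
    by (intro ncomp_pair ncomp_proj) auto
  ultimately have "ncomp A 2 (\<lambda>xs. if P (xs ! 1) (xs ! 0) then 0 else 1)"
    unfolding computable_in_iff_ncomp
    using ncomp_comp1[of A "\<lambda>p. if P (pfst p) (psnd p) then 0 else 1" 2
        "\<lambda>xs. prod_encode (xs ! 1, xs ! 0)"] by simp
  then obtain h where h: "\<And>xs. length xs = 2 \<Longrightarrow> reval A h xs (if P (xs ! 1) (xs ! 0) then 0 else 1)"
    by (rule ncompE) blast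
  have h': "reval A h [m, x] (if P x m then 0 else 1)" for m x
    using h[of "[m, x]"] by simp
  have "enc (Comp (Mu h) [const_prog x]) \<in> jump A \<longleftrightarrow> (\<exists>m. P x m)" for x
    using reval_search_iff[OF h'] inj_enc unfolding jump_def by blast
  moreover have "computable_in (chi (jump A)) (\<lambda>x. chi (jump A) (enc (Comp (Mu h) [const_prog x])))"
    unfolding enc.simps list.map by (intro computable_in_oracle comp_intros)
  ultimately show ?thesis unfolding decidable_in_iff by (simp add: chi_def)
qed

text \<open>The graph of \<open>A\<close> becomes an existential statement with a dummy quantifier,
  hence is decidable in the jump; the value is then found by search.\<close>

lemma computable_in_jump: "computable_in (chi (jump A)) A"
proof -
  have "decidable_in (chi (jump A)) (\<lambda>x. \<exists>m::nat. A (psnd x) = pfst x)"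
    by (rule decidable_in_jump_ex) (intro comp_intros computable_in_oracle)
  then have "decidable_in (chi (jump A)) (\<lambda>x. A (psnd x) = pfst x)" by simp
  from computable_in_Least[OF this] have "computable_in (chi (jump A)) (\<lambda>x. LEAST n. A x = n)"
    by blast
  then show ?thesis by (simp add: Least_equality)
qed

lemma computable_in_jump_mono:
  assumes "computable_in A B"
  shows "computable_in (chi (jump A)) (chi (jump B))"
proof -
  have "decidable_in (chi (jump A)) (\<lambda>e. \<exists>m. halts e (map B [0..<m]))"
    by (rule decidable_in_jump_ex) (intro comp_intros computable_in_comp[OF assms])
  then show ?thesis by (simp add: decidable_in_def jump_iff_halts[symmetric])
qed

text \<open>One half of Shoenfield's limit lemma. Whether \<open>F x\<close> still changes after
  stage \<open>s\<close> is an existential question, so the jump can search for the first stage with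
  no later change.\<close>

lemma computable_in_jump_limit:
  assumes F: "computable_in A (\<lambda>p. F (pfst p) (psnd p))"
    and lim: "\<And>x. \<exists>N. \<forall>s\<ge>N. F x s = G x"
  shows "computable_in (chi (jump A)) G"
proof -
  let ?J = "chi (jump A)"
  have F': "computable_in ?J f \<Longrightarrow> computable_in ?J g \<Longrightarrow> computable_in ?J (\<lambda>x. F (f x) (g x))" for f g
    by (rule computable_in_apply2[OF computable_in_trans[OF computable_in_jump F]])
  have F'': "computable_in A f \<Longrightarrow> computable_in A g \<Longrightarrow> computable_in A (\<lambda>x. F (f x) (g x))" for f g
    by (rule computable_in_apply2[OF F])
  have "decidable_in ?J (\<lambda>z. \<exists>t. pfst z \<le> t \<and> F (psnd z) t \<noteq> F (psnd z) (pfst z))"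
    by (rule decidable_in_jump_ex) (intro comp_intros F'')
  then have "decidable_in ?J (\<lambda>z. \<forall>t\<ge>pfst z. F (psnd z) t = F (psnd z) (pfst z))"
    by (drule_tac decidable_in_not) simp
  moreover have ex: "\<exists>s. \<forall>t\<ge>s. F x t = F x s" for x
  proof -
    from lim[of x] obtain N where N: "\<forall>s\<ge>N. F x s = G x" ..
    have "F x t = F x N" if "N \<le> t" for t
      using N[rule_format, OF that] N[rule_format, OF order_refl] by (simp only:)
    then show ?thesis by (intro exI allI impI)
  qed
  ultimately have L: "computable_in ?J (\<lambda>x. LEAST s. \<forall>t\<ge>s. F x t = F x s)"
    by (intro computable_in_Least) auto
  have "F x (LEAST s. \<forall>t\<ge>s. F x t = F x s) = G x" for x
  proof -
    from lim[of x] obtain N where N: "\<forall>s\<ge>N. F x s = G x" ..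
    define s where "s = (LEAST s. \<forall>t\<ge>s. F x t = F x s)"
    have "\<forall>t\<ge>s. F x t = F x s" unfolding s_def by (rule LeastI_ex[OF ex])
    then have "F x (max s N) = F x s" by (elim allE impE) auto
    moreover have "F x (max s N) = G x" using N by simp
    ultimately show ?thesis by (simp only: s_def[symmetric])
  qed
  moreover have "computable_in ?J (\<lambda>x. F x (LEAST s. \<forall>t\<ge>s. F x t = F x s))"
    by (intro F' L comp_intros)
  ultimately show ?thesis by (simp only:)
qed

section \<open>Descending sequences in exponentials\<close>

lemma omega_le_Nil [simp]: "omega_le R [] ys"
  and omega_le_Cons_Nil [simp]: "\<not> omega_le R (x # xs) []"
  by (auto simp: omega_le_def)

lemma omega_le_Cons [simp]:
  "omega_le R (x # xs) (y # ys) \<longleftrightarrow> x = y \<and> omega_le R xs ys \<or> x \<noteq> y \<and> (x, y) \<in> R"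
  by (auto simp: omega_le_def Ex_less_Suc2)

lemma omega_le_refl: "omega_le R xs xs"
  by (simp add: omega_le_def)

lemma omega_le_append [simp]: "omega_le R (zs @ xs) (zs @ ys) \<longleftrightarrow> omega_le R xs ys"
  by (induction zs) auto

lemma omega_le_prefix:
  "take k xs = take k ys \<Longrightarrow> length xs \<le> k \<Longrightarrow> k \<le> length ys \<Longrightarrow> omega_le R xs ys"
  by (auto simp: omega_le_def)

lemma omega_le_nth:
  "omega_le R xs ys \<Longrightarrow> take k xs = take k ys \<Longrightarrow> k < length xs \<Longrightarrow> k < length ys \<Longrightarrow>
    xs ! k = ys ! k \<or> (xs ! k, ys ! k) \<in> R"
proof (induction k arbitrary: xs ys)
  case 0
  then show ?case by (cases xs; cases ys) auto
next
  case (Suc k)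
  then show ?case by (cases xs; cases ys) auto
qed

lemma omega_le_antisym:
  assumes "antisym R"
  shows "omega_le R xs ys \<Longrightarrow> omega_le R ys xs \<Longrightarrow> xs = ys"
proof (induction xs arbitrary: ys)
  case Nil
  then show ?case by (cases ys) auto
next
  case (Cons x xs)
  then show ?case using antisymD[OF assms] by (cases ys) auto
qed

lemma omega_le_trans:
  assumes R: "trans R" "antisym R"
  shows "omega_le R xs ys \<Longrightarrow> omega_le R ys zs \<Longrightarrow> omega_le R xs zs"
proof (induction xs arbitrary: ys zs)
  case (Cons x xs)
  then obtain y ys' where ys: "ys = y # ys'" by (cases ys) auto
  with Cons.prems obtain z zs' where zs: "zs = z # zs'" by (cases zs) auto
  have "(x, z) \<in> R" if "(x, y) \<in> R" "(y, z) \<in> R" using that by (rule transD[OF R(1)])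
  moreover have "x = y" if "(x, y) \<in> R" "(y, x) \<in> R" using that by (rule antisymD[OF R(2)])
  ultimately show ?case
    using Cons.IH[of ys' zs'] Cons.prems unfolding ys zs by (cases "x = z") auto
qed simp

lemma omega_le_total:
  assumes R: "total_on D R"
  shows "set xs \<subseteq> D \<Longrightarrow> set ys \<subseteq> D \<Longrightarrow> omega_le R xs ys \<or> omega_le R ys xs"
proof (induction xs arbitrary: ys)
  case (Cons x xs)
  then show ?case using R by (cases ys) (auto simp: total_on_def)
qed simp

definition linear :: "lo \<Rightarrow> bool" where "linear X \<longleftrightarrow> linear_order_on (fst X) (snd X)"

lemma linearD:
  assumes "linear X"
  shows "snd X \<subseteq> fst X \<times> fst X" "x \<in> fst X \<Longrightarrow> (x, x) \<in> snd X" "trans (snd X)"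
    "antisym (snd X)" "total_on (fst X) (snd X)"
  using assms by (auto simp: linear_def order_on_defs refl_on_def)

lemma fst_omega_exp_iff: "a \<in> fst (omega_exp X) \<longleftrightarrow> list_decode a \<in> omega_strings X"
  unfolding omega_exp_def by (auto intro: image_eqI[where x="list_decode a"])

lemma snd_omega_exp_iff:
  "(a, b) \<in> snd (omega_exp X) \<longleftrightarrow> list_decode a \<in> omega_strings X \<and>
    list_decode b \<in> omega_strings X \<and> omega_le (snd X) (list_decode a) (list_decode b)"
proof -
  have "(\<exists>xs ys. (a, b) = (list_encode xs, list_encode ys) \<and> P xs ys) \<longleftrightarrow>
      P (list_decode a) (list_decode b)" for P
    by (metis list_decode_inverse list_encode_inverse prod.inject)
  then show ?thesis by (simp add: omega_exp_def)
qed

lemma linear_omega_exp: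
  assumes "linear X"
  shows "linear (omega_exp X)"
proof -
  note X = linearD[OF assms]
  have "trans (snd (omega_exp X))"
    by (rule transI) (auto simp: snd_omega_exp_iff intro: omega_le_trans[OF X(3,4)])
  moreover have "antisym (snd (omega_exp X))"
  proof (rule antisymI)
    fix a b assume "(a, b) \<in> snd (omega_exp X)" "(b, a) \<in> snd (omega_exp X)"
    then have "list_decode a = list_decode b"
      by (intro omega_le_antisym[OF X(4)]) (auto simp: snd_omega_exp_iff)
    then show "a = b" by (metis list_decode_inverse)
  qed
  moreover have "total_on (fst (omega_exp X)) (snd (omega_exp X))"
    unfolding total_on_def
  proof (intro ballI impI)
    fix a b assume "a \<in> fst (omega_exp X)" "b \<in> fst (omega_exp X)"
    then show "(a, b) \<in> snd (omega_exp X) \<or> (b, a) \<in> snd (omega_exp X)"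
      using omega_le_total[OF X(5), of "list_decode a" "list_decode b"]
      by (simp add: fst_omega_exp_iff snd_omega_exp_iff) (simp add: omega_strings_def)
  qed
  moreover have "snd (omega_exp X) \<subseteq> fst (omega_exp X) \<times> fst (omega_exp X)"
    by (auto simp: fst_omega_exp_iff snd_omega_exp_iff)
  ultimately show ?thesis
    unfolding linear_def order_on_defs refl_on_def
    by (auto simp: fst_omega_exp_iff snd_omega_exp_iff omega_le_refl)
qed

lemma linear_omega_iter: "linear X \<Longrightarrow> linear (omega_iter n X)"
  by (induction n) (auto simp: omega_iter_def linear_omega_exp)

lemma omega_iter_Suc: "omega_iter (Suc n) X = omega_exp (omega_iter n X)"
  by (simp add: omega_iter_def)

lemma descending_iff:
  "descending X f \<longleftrightarrow> (\<forall>i. f i \<in> fst X \<and> (f (Suc i), f i) \<in> snd X \<and> f (Suc i) \<noteq> f i)"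
  by (simp add: descending_def split: prod.split)

lemma decreasing_le:
  fixes a :: "nat \<Rightarrow> 'a"
  assumes "trans R" "\<And>i. (a i, a i) \<in> R" "\<And>i. (a (Suc i), a i) \<in> R" "i \<le> j"
  shows "(a j, a i) \<in> R"
  using assms(4) by (induction j rule: dec_induct) (use assms(1-3) in \<open>auto dest: transD\<close>)

section \<open>Stabilising prefixes and the cost of one exponential\<close>

definition stable :: "(nat \<Rightarrow> 'a list) \<Rightarrow> nat \<Rightarrow> nat \<Rightarrow> bool" where
  "stable s k N \<longleftrightarrow> (\<forall>i\<ge>N. take k (s i) = take k (s N) \<and> k \<le> length (s i))"

lemma stable_length: "stable s k N \<Longrightarrow> N \<le> i \<Longrightarrow> k \<le> length (s i)"
  unfolding stable_def by blast

lemma stable_take: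
  assumes "stable s k N" "N \<le> i" "N \<le> j"
  shows "take k (s i) = take k (s j)"
proof -
  have "take k (s i) = take k (s N)" "take k (s j) = take k (s N)"
    using assms unfolding stable_def by blast+
  then show ?thesis by (simp only:)
qed

lemma stable_Suc:
  assumes "stable s k N" "N \<le> M" and M: "\<And>i. M \<le> i \<Longrightarrow> k < length (s i) \<and> s i ! k = s M ! k"
  shows "stable s (Suc k) M"
  unfolding stable_def
proof (intro allI impI)
  fix i assume "M \<le> i"
  moreover from this have "take k (s i) = take k (s M)"
    by (intro stable_take[OF assms(1)]) (use assms(2) in simp_all)
  ultimately show "take (Suc k) (s i) = take (Suc k) (s M) \<and> Suc k \<le> length (s i)"
    using M[of i] M[of M] by (simp add: take_Suc_conv_app_nth)
qed

text \<open>Repetitions are skipped by searching for the next index with a different value;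
  \<open>inf\<close> makes this search total.\<close>

lemma descending_subsequence:
  assumes X: "linear X" and a: "computable_in A a"
    and dec: "\<And>i. (a (Suc i), a i) \<in> snd X" and inf: "\<And>N. \<exists>i\<ge>N. a i \<noteq> a N"
  shows "\<exists>g. computable_in A g \<and> descending X g"
proof (intro exI conjI)
  let ?next = "\<lambda>r. LEAST j. r \<le> j \<and> a j \<noteq> a r"
  let ?idx = "\<lambda>n. rec_nat 0 (\<lambda>_ r. ?next r) n"
  have step: "computable_in A ?next"
    by (rule computable_in_Least) (intro comp_intros computable_in_comp[OF a], use inf in blast)
  have nx: "computable_in A (\<lambda>p. ?next (pfst (psnd p)))"
    by (rule computable_in_comp[OF step]) (intro comp_intros)
  show "computable_in A (\<lambda>n. a (?idx n))"
    by (rule computable_in_comp[OF a]) (intro computable_in_rec nx comp_intros)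
  have D: "a i \<in> fst X" for i using dec linearD(1)[OF X] by blast
  have next_prop: "r \<le> ?next r \<and> a (?next r) \<noteq> a r" for r
    using LeastI_ex[OF inf[of r]] .
  have "(a (?next r), a r) \<in> snd X" for r
    using next_prop[of r] decreasing_le[OF linearD(3)[OF X], of a] linearD(2)[OF X D] dec by blast
  then show "descending X (\<lambda>n. a (?idx n))"
    using next_prop D by (auto simp: descending_iff)
qed

lemma omega_exp_descending_reduce:
  assumes X: "linear X" and f: "computable_in A f" and desc: "descending (omega_exp X) f"
  shows "\<exists>g. computable_in (chi (jump A)) g \<and> descending X g"
proof -
  note R = linearD[OF X]
  define s where "s i = list_decode (f i)" for i
  have s: "s i \<in> omega_strings X" "omega_le (snd X) (s (Suc i)) (s i)" "s (Suc i) \<noteq> s i" for i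
  proof -
    have "(f (Suc i), f i) \<in> snd (omega_exp X)" "f (Suc i) \<noteq> f i"
      using desc by (auto simp: descending_iff)
    then show "s i \<in> omega_strings X" "omega_le (snd X) (s (Suc i)) (s i)" "s (Suc i) \<noteq> s i"
      unfolding s_def snd_omega_exp_iff by (auto dest: arg_cong[where f=list_encode])
  qed
  have s_comp: "computable_in B f \<Longrightarrow> computable_in B g \<Longrightarrow> list_computable_in B (\<lambda>x. s (g x))" for B g
    unfolding s_def by (rule list_computable_in_decode, rule computable_in_comp)
  have s_le: "omega_le (snd X) (s j) (s i)" if "i \<le> j" for i j
    using that by (induction j rule: dec_induct)
      (auto intro: omega_le_refl omega_le_trans[OF R(3,4)] s)
  have nth_in: "s i ! k \<in> fst X" if "k < length (s i)" for i k
    using s(1)[of i] that by (auto simp: omega_strings_def)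
  \<comment> \<open>A string consisting of just the stable prefix would be a prefix of its
    successor, hence not above it.\<close>
  have longer: "k < length (s i)" if st: "stable s k N" "N \<le> i" for k N i
  proof (rule ccontr)
    assume "\<not> k < length (s i)"
    moreover have "take k (s i) = take k (s (Suc i))" "k \<le> length (s (Suc i))"
      using stable_take[OF st(1), of i "Suc i"] stable_length[OF st(1), of "Suc i"] st(2) by simp_all
    ultimately have "omega_le (snd X) (s i) (s (Suc i))"
      by (intro omega_le_prefix) auto
    from omega_le_antisym[OF R(4) this s(2)] show False using s(3)[of i] by simp
  qed
  have entry: "(s (Suc i) ! k, s i ! k) \<in> snd X" if st: "stable s k N" "N \<le> i" for k N i
  proof -
    have k: "k < length (s (Suc i))" "k < length (s i)" using longer[OF st(1)] st(2) by auto
    have "take k (s (Suc i)) = take k (s i)"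
      by (rule stable_take[OF st(1)]) (use st(2) in simp_all)
    from omega_le_nth[OF s(2) this k] show ?thesis
      using R(2)[OF nth_in[OF k(2)]] by metis
  qed
  have f': "computable_in (chi (jump A)) f" by (rule computable_in_trans[OF computable_in_jump f])
  show ?thesis
  proof (cases "\<forall>k. \<exists>N. stable s k N")
    case False
    have "stable s 0 0" by (simp add: stable_def)
    have "\<exists>k. (\<exists>N. stable s k N) \<and> (\<nexists>M. stable s (Suc k) M)"
    proof (rule ccontr)
      assume "\<not> (\<exists>k. (\<exists>N. stable s k N) \<and> (\<nexists>M. stable s (Suc k) M))"
      then have "\<exists>N. stable s k N" for k
        by (induction k) (use \<open>stable s 0 0\<close> in blast)+
      with False show False by blast
    qed
    then obtain k N where k: "stable s k N" "\<nexists>M. stable s (Suc k) M" by blast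
    \<comment> \<open>Entry \<open>k\<close> behind the final prefix can only decrease, and being
      eventually constant would make the next prefix stable too.\<close>
    let ?a = "\<lambda>i. nth0 (s (N + i)) k"
    have nth0: "?a i = s (N + i) ! k" for i using longer[OF k(1)] by simp
    have "computable_in (chi (jump A)) ?a" by (intro comp_intros s_comp f')
    moreover have "(?a (Suc i), ?a i) \<in> snd X" for i
      using entry[OF k(1), of "N + i"] longer[OF k(1)] by simp
    moreover have "\<exists>i\<ge>M. ?a i \<noteq> ?a M" for M
    proof (rule ccontr)
      assume *: "\<not> (\<exists>i\<ge>M. ?a i \<noteq> ?a M)"
      have const: "s (N + i) ! k = s (N + M) ! k" if "M \<le> i" for i
      proof -
        have "?a i = ?a M" using * that by blast
        then show ?thesis by (simp only: nth0)
      qed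
      have "stable s (Suc k) (N + M)"
      proof (rule stable_Suc[OF k(1)])
        fix i assume "N + M \<le> i"
        then show "k < length (s i) \<and> s i ! k = s (N + M) ! k"
          using const[of "i - N"] longer[OF k(1)] by simp
      qed simp
      with k(2) show False by blast
    qed
    ultimately show ?thesis by (rule descending_subsequence[OF X])
  next
    case True
    then obtain Nf where Nf: "\<And>k. stable s k (Nf k)" by metis
    define G where "G k = s (Nf (Suc k)) ! k" for k
    have lim: "s i ! j = G j" "j < length (s i)" if "Nf (Suc j) \<le> i" for j i
    proof -
      have "take (Suc j) (s i) = take (Suc j) (s (Nf (Suc j)))" "j < length (s i)"
        using stable_take[OF Nf that order_refl] stable_length[OF Nf that] by simp_all
      then show "s i ! j = G j" "j < length (s i)"
        unfolding G_def by (metis lessI nth_take)+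
    qed
    have "computable_in (chi (jump A)) G"
    proof (rule computable_in_jump_limit)
      show "computable_in A (\<lambda>p. nth0 (s (psnd p)) (pfst p))" by (intro comp_intros s_comp f)
      show "\<exists>N. \<forall>i\<ge>N. nth0 (s i) k = G k" for k
        using lim[of k] by (intro exI[of _ "Nf (Suc k)"]) auto
    qed
    moreover have "(G (Suc k), G k) \<in> snd X" for k
    proof -
      let ?i = "max (Nf (Suc k)) (Nf (Suc (Suc k)))"
      have "sorted_wrt (\<lambda>a b. (b, a) \<in> snd X) (s ?i)" using s(1) by (simp add: omega_strings_def)
      then show ?thesis
        using lim[of k ?i] lim[of "Suc k" ?i] sorted_wrt_nth_less by fastforce
    qed
    \<comment> \<open>If \<open>G\<close> were constant from \<open>K\<close> on, take
      \<open>N\<close> with entries up to \<open>K\<close> final and a later \<open>i\<close> whose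
      final part is longer than all of \<open>s N\<close>. Then \<open>s i\<close> is smaller than
      \<open>s N\<close> without being a prefix, so at some \<open>j\<close> above \<open>K\<close>
      its entry \<open>G K\<close> is strictly below \<open>s N ! j\<close>, although
      \<open>s N\<close> does not increase after its entry \<open>G K\<close> at
      \<open>K\<close>.\<close>
    moreover have "\<exists>i\<ge>K. G i \<noteq> G K" for K
    proof (rule ccontr)
      assume "\<not> (\<exists>i\<ge>K. G i \<noteq> G K)"
      then have const: "\<And>i. i \<ge> K \<Longrightarrow> G i = G K" by blast
      define N where "N = Nf (Suc K)"
      define L where "L = length (s N)"
      define i where "i = max N (Max (Nf ` {..Suc L}))"
      have iN: "N \<le> i" and iL: "\<And>j. j \<le> Suc L \<Longrightarrow> Nf j \<le> i"
        by (auto simp: i_def intro!: max.coboundedI2)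
      have "L < length (s i)" using lim(2)[of L i] iL by simp
      with s_le[OF iN] obtain j where j: "j < L" "take j (s i) = take j (s N)"
        "s i ! j \<noteq> s N ! j" "(s i ! j, s N ! j) \<in> snd X"
        unfolding omega_le_def L_def by auto
      have KN: "s N ! K = G K" "K < L" using lim[of K N] by (auto simp: N_def L_def)
      have ij: "s i ! j = G j" using lim[of j i] iL j(1) by simp
      have "K < j"
      proof (rule ccontr)
        assume "\<not> K < j"
        then have "j \<le> K" by simp
        have "take (Suc K) (s i) = take (Suc K) (s N)"
          by (rule stable_take[OF Nf]) (use iN in \<open>simp_all add: N_def\<close>)
        then have "s i ! j = s N ! j" using \<open>j \<le> K\<close> by (metis le_imp_less_Suc nth_take)
        with j(3) show False by simp
      qed
      moreover have "sorted_wrt (\<lambda>a b. (b, a) \<in> snd X) (s N)"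
        using s(1) by (simp add: omega_strings_def)
      ultimately have "(s N ! j, G K) \<in> snd X"
        using j(1) KN sorted_wrt_nth_less unfolding L_def by fastforce
      moreover have "(G K, s N ! j) \<in> snd X" using j(4) ij const[of j] \<open>K < j\<close> by simp
      ultimately have "s N ! j = G K" using R(4) by (auto dest: antisymD)
      then show False using j(3) ij const[of j] \<open>K < j\<close> by simp
    qed
    ultimately show ?thesis by (rule descending_subsequence[OF X])
  qed
qed

text \<open>The outermost exponential is removed first, at the price of one jump, so the induction
  must allow any starting jump \<open>m\<close>.\<close>

lemma omega_iter_descending_reduce:
  assumes "linear X"
  shows "computable_in (chi (jumpn m)) f \<Longrightarrow> descending (omega_iter n X) f \<Longrightarrow>
    \<exists>g. computable_in (chi (jumpn (m + n))) g \<and> descending X g"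
proof (induction n arbitrary: m f)
  case 0
  then show ?case by (auto simp: omega_iter_def)
next
  case (Suc n)
  from omega_exp_descending_reduce[OF linear_omega_iter[OF assms] Suc.prems(1)] Suc.prems(2)
  obtain g where "computable_in (chi (jumpn (Suc m))) g" "descending (omega_iter n X) g"
    by (auto simp: omega_iter_Suc)
  from Suc.IH[OF this] show ?case by simp
qed

section \<open>Iterated true stages\<close>

text \<open>
  The true stages seen after reading \<open>m\<close> entries of \<open>\<sigma>\<close>. Entry \<open>Suc i\<close> of the result carries a
  guess whether program \<open>i\<close> halts; a new entry discards everything after the first guess that it
  refutes. The first disjunct only makes the minimum exist.
\<close>

definition stages :: "nat list \<Rightarrow> nat \<Rightarrow> nat list" where
  "stages \<sigma> m = rec_nat [] (\<lambda>m c. take (Suc (LEAST i. length c \<le> Suc i \<or>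
    halts i (take (Suc m) \<sigma>) \<and> \<not> halts i (take m \<sigma>))) c @ [nth0 \<sigma> m]) m"

lemma stages_0 [simp]: "stages \<sigma> 0 = []"
  and stages_Suc: "stages \<sigma> (Suc m) = take (Suc (LEAST i. length (stages \<sigma> m) \<le> Suc i \<or>
    halts i (take (Suc m) \<sigma>) \<and> \<not> halts i (take m \<sigma>))) (stages \<sigma> m) @ [nth0 \<sigma> m]"
  by (simp_all add: stages_def)

lemma stages_take: "m \<le> k \<Longrightarrow> stages (take k \<sigma>) m = stages \<sigma> m"
proof (induction m)
  case (Suc m)
  then have "nth0 (take k \<sigma>) m = nth0 \<sigma> m" by (simp add: nth0_def)
  with Suc show ?case by (simp add: stages_Suc min_def)
qed simp

text \<open>Entry \<open>i\<close> was appended when some position \<open>a\<close> was read. It has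
  survived every later step, so no program below \<open>i\<close> has been newly seen to halt since
  then.\<close>

lemma stages_nth:
  assumes "m \<le> length \<sigma>" "i < length (stages \<sigma> m)"
  shows "\<exists>a<m. stages \<sigma> m ! i = \<sigma> ! a \<and> stages \<sigma> (Suc a) = take (Suc i) (stages \<sigma> m) \<and>
    (\<forall>e<i. halts e (take m \<sigma>) \<longrightarrow> halts e (take (Suc a) \<sigma>))"
  using assms
proof (induction m arbitrary: i)
  case (Suc m)
  define c where "c = stages \<sigma> m"
  define l where "l = (LEAST i. length c \<le> Suc i \<or>
    halts i (take (Suc m) \<sigma>) \<and> \<not> halts i (take m \<sigma>))"
  have S: "stages \<sigma> (Suc m) = take (Suc l) c @ [\<sigma> ! m]"
    using Suc.prems(1) by (simp add: stages_Suc c_def l_def)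
  show ?case
  proof (cases "i < length (take (Suc l) c)")
    case True
    then have i: "i \<le> l" "i < length c" by auto
    from Suc.IH[of i] i Suc.prems(1) obtain a where a: "a < m" "c ! i = \<sigma> ! a"
      "stages \<sigma> (Suc a) = take (Suc i) c"
      "\<forall>e<i. halts e (take m \<sigma>) \<longrightarrow> halts e (take (Suc a) \<sigma>)"
      by (auto simp: c_def)
    have "halts e (take m \<sigma>)" if "e < i" "halts e (take (Suc m) \<sigma>)" for e
      using not_less_Least[of e "\<lambda>i. length c \<le> Suc i \<or>
        halts i (take (Suc m) \<sigma>) \<and> \<not> halts i (take m \<sigma>)"] that i(1)
      unfolding l_def[symmetric] by auto
    moreover have "stages \<sigma> (Suc m) ! i = c ! i" "take (Suc i) (stages \<sigma> (Suc m)) = take (Suc i) c"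
      using i by (simp_all add: S nth_append min_def)
    ultimately show ?thesis using a by (intro exI[of _ a]) auto
  next
    case False
    with Suc.prems(2) have i: "i = length (take (Suc l) c)" unfolding S by (simp del: length_take)
    have "stages \<sigma> (Suc m) ! i = \<sigma> ! m" unfolding S i by (rule nth_append_length)
    moreover have "length (stages \<sigma> (Suc m)) = Suc i" unfolding S i by (simp only: length_append) simp
    ultimately show ?thesis by (intro exI[of _ m]) simp
  qed
qed simp

lemma list_computable_in_stages [comp_intros]:
  assumes F: "list_computable_in A F" and m: "computable_in A m"
  shows "list_computable_in A (\<lambda>x. stages (F x) (m x))"
  unfolding stages_def
proof (intro list_computable_in_rec m comp_intros)
  show "computable_in A (\<lambda>p. LEAST i. length (list_decode (pfst (psnd p))) \<le> Suc i \<or>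
      halts i (take (Suc (pfst p)) (F (psnd (psnd p)))) \<and>
      \<not> halts i (take (pfst p) (F (psnd (psnd p)))))"
  proof (rule computable_in_Least)
    show "\<exists>i. length (list_decode (pfst (psnd p))) \<le> Suc i \<or>
        halts i (take (Suc (pfst p)) (F (psnd (psnd p)))) \<and>
        \<not> halts i (take (pfst p) (F (psnd (psnd p))))" for p
      by (rule exI[of _ "length (list_decode (pfst (psnd p)))"]) simp
  qed (intro comp_intros list_computable_in_comp[OF F])
qed (intro comp_intros list_computable_in_comp[OF F])+

text \<open>\<open>chain k t\<close> lists the predecessors of \<open>t\<close>, up to \<open>t\<close> itself, in the tree of level \<open>k\<close>.\<close>

primrec chain :: "nat \<Rightarrow> nat \<Rightarrow> nat list" where
  "chain 0 t = [0..<Suc t]"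
| "chain (Suc k) t = stages (chain k t) (length (chain k t))"

lemma list_computable_in_chain [comp_intros]:
  "computable_in A f \<Longrightarrow> list_computable_in A (\<lambda>x. chain k (f x))"
proof (induction k)
  case 0
  have "list_computable_in A (\<lambda>x. map (\<lambda>i. i) [0..<Suc (f x)])"
    by (intro comp_intros 0)
  then show ?case by simp
next
  case (Suc k)
  then show ?case unfolding chain.simps by (intro comp_intros) auto
qed

lemma chain_last: "chain k t \<noteq> [] \<and> last (chain k t) = t"
proof (induction k)
  case (Suc k)
  then obtain m where "length (chain k t) = Suc m" by (cases "chain k t") auto
  moreover from this Suc have "chain k t ! m = t" by (metis diff_Suc_1 last_conv_nth)
  ultimately show ?case by (simp add: stages_Suc)
qed simp

lemmas chain_not_Nil [simp] = chain_last[THEN conjunct1]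
  and last_chain [simp] = chain_last[THEN conjunct2]

lemma chain_inject: "chain k s = chain k t \<Longrightarrow> s = t"
  by (metis last_chain)

text \<open>This is what makes each level a tree. Recomputing the chain at an earlier entry reads
  only the part of the lower chain up to that entry, and \<open>stages_nth\<close> says that the
  result at that moment was the initial segment.\<close>

lemma chain_nth: "i < length (chain k t) \<Longrightarrow> chain k (chain k t ! i) = take (Suc i) (chain k t)"
proof (induction k arbitrary: t i)
  case 0
  then show ?case by (auto simp del: upt_Suc simp add: take_upt)
next
  case (Suc k)
  define \<sigma> where "\<sigma> = chain k t"
  from stages_nth[of "length \<sigma>" \<sigma> i] Suc.prems obtain a where
    a: "a < length \<sigma>" "chain (Suc k) t ! i = \<sigma> ! a"
      "stages \<sigma> (Suc a) = take (Suc i) (chain (Suc k) t)"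
    by (auto simp: \<sigma>_def)
  have "chain k (\<sigma> ! a) = take (Suc a) \<sigma>" using Suc.IH a(1) by (simp add: \<sigma>_def)
  with a have "chain (Suc k) (\<sigma> ! a) = stages \<sigma> (Suc a)" by (simp add: stages_take)
  with a show ?case by simp
qed

lemma set_chain_Suc: "set (chain (Suc k) t) \<subseteq> set (chain k t)"
proof
  fix u assume "u \<in> set (chain (Suc k) t)"
  then obtain i where "i < length (chain (Suc k) t)" "u = chain (Suc k) t ! i"
    by (metis in_set_conv_nth)
  with stages_nth[of "length (chain k t)" "chain k t" i] show "u \<in> set (chain k t)"
    by auto
qed

lemma chain_nth_ancestor:
  "i < j \<Longrightarrow> j < length (chain k t) \<Longrightarrow> chain k t ! i \<in> set (butlast (chain k (chain k t ! j)))"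
  by (auto simp: chain_nth butlast_take in_set_conv_nth intro!: exI[of _ i])

section \<open>Infinite paths and the jumps they compute\<close>

definition path :: "nat \<Rightarrow> (nat \<Rightarrow> nat) \<Rightarrow> bool" where
  "path k P \<longleftrightarrow> (\<forall>i. chain k (P i) = map P [0..<Suc i])"

text \<open>The level \<open>k\<close> chains of the stages \<open>P i\<close> are nested and grow,
  so they unite to a path \<open>Q\<close>. Since \<open>P (Suc e)\<close> is never discarded, the
  guess about program \<open>e\<close> made there is final: it halts relative to \<open>Q\<close>
  iff it has been seen to halt by that stage.\<close>

lemma path_Suc_computes_jump:
  assumes P: "path (Suc k) P"
  shows "\<exists>Q. path k Q \<and> computable_in P (chi (jump Q))"
proof -
  define C where "C i = chain k (P i)" for i
  have chP: "chain (Suc k) (P i) = map P [0..<Suc i]" for i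
    using P unfolding path_def by blast
  have inj: "i = j" if "P i = P j" for i j
    using arg_cong[OF that, of "\<lambda>t. length (chain (Suc k) t)"] by (simp only: chP) simp
  have prefix: "\<exists>a<length (C j). C j ! a = P i \<and> C i = take (Suc a) (C j)" if "i \<le> j" for i j
  proof -
    have "P i \<in> set (chain (Suc k) (P j))" unfolding chP using that by (simp del: upt_Suc)
    then have "P i \<in> set (C j)" using set_chain_Suc unfolding C_def by blast
    then obtain a where "a < length (C j)" "C j ! a = P i" by (auto simp: in_set_conv_nth)
    then show ?thesis using chain_nth[of a k "P j"] by (auto simp: C_def)
  qed
  have nth_C: "C j ! l = C i ! l" if "i \<le> j" "l < length (C i)" for i j l
    using prefix[OF that(1)] that(2) by auto
  have len_less: "length (C i) < length (C (Suc i))" for i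
  proof -
    obtain a where a: "a < length (C (Suc i))" "C i = take (Suc a) (C (Suc i))"
      using prefix[of i "Suc i"] by auto
    have "C i \<noteq> C (Suc i)" using chain_inject inj[of i "Suc i"] by (auto simp: C_def)
    with a have "Suc a < length (C (Suc i))" by (metis Suc_lessI take_all_iff order_refl)
    with a show ?thesis by simp
  qed
  have len: "i < length (C i)" for i
  proof (induction i)
    case 0
    then show ?case by (simp add: C_def)
  next
    case (Suc i)
    then show ?case using len_less[of i] by linarith
  qed
  \<comment> \<open>The diagonal is well defined because the length of \<open>C i\<close> exceeds
    \<open>i\<close>, and nestedness makes the choice of chain irrelevant.\<close>
  define Q where "Q i = C i ! i" for i
  have C_eq: "C j = map Q [0..<length (C j)]" for j
  proof (rule nth_equalityI)
    fix l assume l: "l < length (C j)"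
    have "C j ! l = C l ! l"
      using nth_C[of l j l] nth_C[of j l l] len[of l] l by (cases "l \<le> j") auto
    then show "C j ! l = map Q [0..<length (C j)] ! l" using l by (simp add: Q_def)
  qed simp
  have "chain k (Q i) = map Q [0..<Suc i]" for i
  proof -
    have "chain k (Q i) = take (Suc i) (C i)"
      unfolding Q_def C_def using len[of i] by (intro chain_nth) (simp add: C_def)
    also have "\<dots> = map Q [0..<Suc i]"
      by (subst C_eq) (use len[of i] in \<open>simp add: take_map take_upt del: upt_Suc\<close>)
    finally show ?thesis .
  qed
  then have "path k Q" by (simp add: path_def)
  have "e \<in> jump Q \<longleftrightarrow> halts e (chain k (P (Suc e)))" for e
  proof
    assume "e \<in> jump Q"
    then obtain m where m: "halts e (map Q [0..<m])" by (auto simp: jump_iff_halts)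
    define j where "j = max m (Suc e)"
    have "m \<le> length (C j)" using len[of j] by (simp add: j_def)
    then have "halts e (C j)"
      using halts_mono[OF m] by (subst C_eq) (simp only: map_upt_append)
    moreover have "Suc e < length (chain (Suc k) (P j))" unfolding chP by (simp add: j_def)
    ultimately obtain a where a: "a < length (C j)" "chain (Suc k) (P j) ! Suc e = C j ! a"
      "halts e (take (Suc a) (C j))"
      using stages_nth[of "length (C j)" "C j" "Suc e"] by (auto simp: C_def)
    have "C j ! a = P (Suc e)" using a(2) unfolding chP by (simp add: j_def del: upt_Suc)
    then have "take (Suc a) (C j) = chain k (P (Suc e))"
      using chain_nth[of a k "P j"] a(1) by (simp add: C_def)
    with a(3) show "halts e (chain k (P (Suc e)))" by simp
  next
    assume "halts e (chain k (P (Suc e)))"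
    then show "e \<in> jump Q" using C_eq[of "Suc e"] unfolding C_def jump_iff_halts by metis
  qed
  moreover have "decidable_in P (\<lambda>e. halts e (chain k (P (Suc e))))"
    by (intro comp_intros computable_in_oracle)
  ultimately have "decidable_in P (\<lambda>e. e \<in> jump Q)" by simp
  then have "computable_in P (chi (jump Q))" by (simp add: decidable_in_def)
  with \<open>path k Q\<close> show ?thesis by blast
qed

text \<open>The path \<open>Q\<close> one level down computes \<open>jumpn k\<close> by induction,
  so monotonicity of the jump lifts this to \<open>jump Q\<close>, which \<open>P\<close>
  computes.\<close>

lemma path_computes_jumpn: "path k P \<Longrightarrow> computable_in P (chi (jumpn k))"
proof (induction k arbitrary: P)
  case 0
  show ?case by (simp add: chi_def[abs_def] computable_in_const)
next
  case (Suc k)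
  then obtain Q where "path k Q" and Q: "computable_in P (chi (jump Q))"
    using path_Suc_computes_jump by blast
  from computable_in_jump_mono[OF Suc.IH[OF this(1)]] show ?case
    using computable_in_trans[OF Q] by simp
qed

section \<open>The Kleene-Brouwer order and its descending sequences\<close>

definition ge_rel :: "(nat \<times> nat) set" where "ge_rel = {(a, b). b \<le> a}"

text \<open>
  In the Kleene-Brouwer order extensions are smaller, so it is the converse of the order of
  \<open>omega_le\<close> over the reversed natural numbers.
\<close>

definition kb_order :: "nat \<Rightarrow> lo" where
  "kb_order n = (UNIV, {(s, t). omega_le ge_rel (chain n t) (chain n s)})"

lemma snd_kb_order_iff: "(s, t) \<in> snd (kb_order n) \<longleftrightarrow> omega_le ge_rel (chain n t) (chain n s)"
  by (simp add: kb_order_def)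

lemma ge_rel: "trans ge_rel" "antisym ge_rel" "total_on UNIV ge_rel"
  by (auto simp: ge_rel_def trans_def antisym_def total_on_def)

lemma linear_kb_order: "linear (kb_order n)"
proof -
  have "trans (snd (kb_order n))"
    by (rule transI) (auto simp: snd_kb_order_iff intro: omega_le_trans[OF ge_rel(1,2)])
  moreover have "antisym (snd (kb_order n))"
    by (rule antisymI) (auto simp: snd_kb_order_iff intro: chain_inject omega_le_antisym[OF ge_rel(2)])
  moreover have "total_on UNIV (snd (kb_order n))"
    using omega_le_total[OF ge_rel(3)] by (auto simp: total_on_def snd_kb_order_iff)
  ultimately show ?thesis
    unfolding linear_def order_on_defs refl_on_def
    by (auto simp: snd_kb_order_iff omega_le_refl) (auto simp: kb_order_def)
qed

lemma decidable_in_omega_le_ge: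
  assumes F: "list_computable_in A F" and G: "list_computable_in A G"
  shows "decidable_in A (\<lambda>x. omega_le ge_rel (F x) (G x))"
proof -
  have *: "omega_le ge_rel xs ys \<longleftrightarrow> (length xs \<le> length ys \<and> take (length xs) ys = xs) \<or>
     (\<exists>i<length xs. i < length ys \<and> take i xs = take i ys \<and>
        nth0 xs i \<noteq> nth0 ys i \<and> nth0 ys i \<le> nth0 xs i)" for xs ys
    by (auto simp: omega_le_def ge_rel_def)
  show ?thesis
    unfolding * by (intro comp_intros F G list_computable_in_comp[OF F] list_computable_in_comp[OF G])
qed

lemma comp_lin_order_kb_order: "comp_lin_order (kb_order n)"
proof -
  have "prod_encode ` snd (kb_order n) = {x. omega_le ge_rel (chain n (psnd x)) (chain n (pfst x))}"
  proof (intro set_eqI iffI)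
    fix x assume "x \<in> {x. omega_le ge_rel (chain n (psnd x)) (chain n (pfst x))}"
    then have "(pfst x, psnd x) \<in> snd (kb_order n)" by (simp add: snd_kb_order_iff)
    from imageI[OF this, of prod_encode] show "x \<in> prod_encode ` snd (kb_order n)" by simp
  qed (auto simp: snd_kb_order_iff)
  moreover have "decidable_in A (\<lambda>x. omega_le ge_rel (chain n (psnd x)) (chain n (pfst x)))" for A
    by (intro decidable_in_omega_le_ge comp_intros)
  moreover have "computable (chi UNIV)"
    by (simp add: computable_def chi_def[abs_def] computable_in_const)
  ultimately show ?thesis
    using linear_kb_order[of n] unfolding comp_lin_order_def linear_def decidable_in_def computable_def
    by (simp add: kb_order_def)
qed

lemma kb_order_ancestor:
  assumes "u \<in> set (butlast (chain n t))"
  shows "(t, u) \<in> snd (kb_order n)" "t \<noteq> u"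
proof -
  obtain i where i: "Suc i < length (chain n t)" "u = chain n t ! i"
    using assms by (auto simp: in_set_conv_nth nth_butlast Suc_less_eq2 less_diff_conv)
  have u: "chain n u = take (Suc i) (chain n t)" using i chain_nth[of i n t] by simp
  then show "(t, u) \<in> snd (kb_order n)" by (simp add: snd_kb_order_iff)
      (rule omega_le_prefix[where k="Suc i"], use i in simp_all)
  show "t \<noteq> u" using arg_cong[OF u, of length] i(1) by auto
qed

lemma eventually_constant_nat:
  fixes b :: "nat \<Rightarrow> nat"
  assumes "\<And>i. b (Suc i) \<le> b i"
  shows "\<exists>M. \<forall>i\<ge>M. b i = b M"
proof -
  obtain M where M: "\<And>i. b M \<le> b i" using ex_has_least_nat[of "\<lambda>_. True" 0 b] by blast
  have "b i \<le> b M" if "M \<le> i" for i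
    using lift_Suc_antimono_le[of b, OF assms that] .
  with M show ?thesis by (intro exI[of _ M]) (blast intro: antisym)
qed

text \<open>Behind a final prefix the next entry is a non-increasing natural number, so here every
  prefix stabilises. The limit is a path, and taking it is the only use of the jump of
  \<open>g\<close>.\<close>

lemma descending_kb_order_computes_path:
  assumes desc: "descending (kb_order n) g"
  shows "\<exists>P. path n P \<and> computable_in (chi (jump g)) P"
proof -
  define s where "s i = chain n (g i)" for i
  have s: "omega_le ge_rel (s i) (s (Suc i))" "s (Suc i) \<noteq> s i" for i
    using desc chain_inject unfolding descending_iff snd_kb_order_iff s_def by blast+
  \<comment> \<open>These strings increase under \<open>omega_le\<close>, so a string that is too
    short contradicts its predecessor; hence the bound starts one step after
    \<open>N\<close>.\<close>
  have longer: "k < length (s i)" if st: "stable s k N" "Suc N \<le> i" for k N i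
  proof (rule ccontr)
    assume short: "\<not> k < length (s i)"
    obtain j where j: "i = Suc j" "N \<le> j" using st(2) by (cases i) auto
    have "take k (s i) = take k (s j)" "k \<le> length (s j)"
      using stable_take[OF st(1), of i j] stable_length[OF st(1), of j] j by simp_all
    with short have "omega_le ge_rel (s i) (s j)" by (intro omega_le_prefix) auto
    from omega_le_antisym[OF ge_rel(2) this] show False using s[of j] j(1) by simp
  qed
  have "\<exists>N. stable s k N" for k
  proof (induction k)
    case 0
    show ?case by (simp add: stable_def)
  next
    case (Suc k)
    then obtain N where N: "stable s k N" ..
    define b where "b i = s (Suc N + i) ! k" for i
    have "b (Suc i) \<le> b i" for i
    proof -
      have "take k (s (Suc N + i)) = take k (s (Suc (Suc N + i)))"
        by (rule stable_take[OF N]) simp_all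
      from omega_le_nth[OF s(1) this] longer[OF N] show ?thesis
        by (auto simp: b_def ge_rel_def)
    qed
    from eventually_constant_nat[of b, OF this] obtain M where M: "\<And>i. i \<ge> M \<Longrightarrow> b i = b M" by blast
    have "stable s (Suc k) (Suc N + M)"
    proof (rule stable_Suc[OF N])
      fix i assume "Suc N + M \<le> i"
      then show "k < length (s i) \<and> s i ! k = s (Suc N + M) ! k"
        using M[of "i - Suc N"] longer[OF N] by (simp add: b_def)
    qed simp
    then show ?case ..
  qed
  then obtain Nf where Nf: "\<And>k. stable s k (Nf k)" by metis
  define P where "P k = s (Nf (Suc k)) ! k" for k
  have lim: "s i ! j = P j" "j < length (s i)" if "Nf (Suc j) \<le> i" for j i
  proof -
    have "take (Suc j) (s i) = take (Suc j) (s (Nf (Suc j)))" "j < length (s i)"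
      using stable_take[OF Nf that order_refl] stable_length[OF Nf that] by simp_all
    then show "s i ! j = P j" "j < length (s i)"
      unfolding P_def by (metis lessI nth_take)+
  qed
  have "computable_in (chi (jump g)) P"
  proof (rule computable_in_jump_limit)
    show "computable_in g (\<lambda>p. nth0 (s (psnd p)) (pfst p))"
      unfolding s_def by (intro comp_intros computable_in_oracle)
    show "\<exists>N. \<forall>i\<ge>N. nth0 (s i) k = P k" for k
      using lim[of k] by (intro exI[of _ "Nf (Suc k)"]) auto
  qed
  moreover have "chain n (P k) = map P [0..<Suc k]" for k
  proof -
    define i where "i = Max (Nf ` {..Suc k})"
    have i: "Nf j \<le> i" if "j \<le> Suc k" for j using that by (simp add: i_def)
    have "chain n (P k) = take (Suc k) (s i)"
      using chain_nth[of k n "g i"] lim[of k i] i[of "Suc k"] by (simp add: s_def)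
    also have "\<dots> = map P [0..<Suc k]"
    proof (rule nth_equalityI)
      show "length (take (Suc k) (s i)) = length (map P [0..<Suc k])"
        using lim(2)[of k i] i[of "Suc k"] by (simp del: upt_Suc)
      fix j assume "j < length (take (Suc k) (s i))"
      then show "take (Suc k) (s i) ! j = map P [0..<Suc k] ! j"
        using lim(1)[of j i] i[of "Suc j"] by (simp del: upt_Suc)
    qed
    finally show ?thesis .
  qed
  ultimately show ?thesis unfolding path_def by blast
qed

section \<open>The embedding into iterated exponentials\<close>

text \<open>
  Of the two final copies of \<open>t\<close>, one remains if the next stage guesses that the question at \<open>t\<close>
  has a negative answer, and is given up when that guess is refuted.
\<close>

definition markers :: "nat \<Rightarrow> nat \<Rightarrow> nat list" where
  "markers k t = map (nth0 (chain (Suc k) t))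
    (filter (\<lambda>i. \<not> halts i (chain k t)) [0..<length (chain (Suc k) t) - 1]) @ [t, t]"

lemma list_computable_in_upt [comp_intros]:
  assumes "computable_in A f"
  shows "list_computable_in A (\<lambda>x. [0..<f x])"
  using list_computable_in_map_upt[of A f "\<lambda>i x. i"] assms computable_in_pfst[OF computable_in_id]
  by simp

lemma list_computable_in_markers [comp_intros]:
  assumes f: "computable_in A f"
  shows "list_computable_in A (\<lambda>x. markers k (f x))"
  unfolding markers_def by (intro comp_intros f computable_in_comp[OF f])

text \<open>Phrased with the tree relation instead of an order, so that any map decreasing along
  level \<open>k + 1\<close> sends the markers to an admissible string.\<close>

lemma markers_sorted:
  "sorted_wrt (\<lambda>u v. v = u \<or> u \<in> set (butlast (chain (Suc k) v))) (markers k t)"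
proof -
  define c where "c = chain (Suc k) t"
  have c: "c \<noteq> []" "last c = t" unfolding c_def by (rule chain_not_Nil last_chain)+
  have anc: "c ! i \<in> set (butlast (chain (Suc k) (c ! j)))" if "i < j" "j < length c" for i j
    using chain_nth_ancestor[OF that(1)] that(2) unfolding c_def .
  have "t = c ! (length c - 1)" using c by (simp add: last_conv_nth)
  then have t: "c ! i \<in> set (butlast (chain (Suc k) t))" if "i < length c - 1" for i
    using anc[of i "length c - 1"] that by simp
  have "sorted_wrt (\<lambda>i j. i < j \<and> j < length c)
      (filter (\<lambda>i. \<not> halts i (chain k t)) [0..<length c - 1])"
    by (rule sorted_wrt_filter) (rule sorted_wrt_mono_rel[OF _ sorted_wrt_upt], auto)
  then have "sorted_wrt (\<lambda>i j. nth0 c i \<in> set (butlast (chain (Suc k) (nth0 c j))))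
      (filter (\<lambda>i. \<not> halts i (chain k t)) [0..<length c - 1])"
    by (rule sorted_wrt_mono_rel[rotated]) (use anc in auto)
  then show ?thesis
    unfolding markers_def c_def[symmetric] sorted_wrt_append sorted_wrt_map
    using t by (auto elim: sorted_wrt_mono_rel[rotated])
qed

text \<open>The new stage attaches below entry \<open>l\<close> of the old chain, and the markers
  before \<open>l\<close> are unchanged; they form \<open>zs\<close>. Either a marker
  \<open>u\<close> is given up and \<open>t\<close>, which lies below \<open>u\<close>, takes its
  place, or one copy of \<open>s\<close> stays and the other is replaced by \<open>t\<close>. With a
  single copy of \<open>s\<close> the old string would be a proper prefix of the new one in the
  second case, and the value would increase.\<close>

lemma markers_extend:
  assumes ext: "chain k t = chain k s @ [t]"
  shows "(\<exists>zs u r. markers k t = zs @ [t, t] \<and> markers k s = zs @ u # r \<and>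
      u \<in> set (butlast (chain (Suc k) t))) \<or>
    (\<exists>zs. markers k t = zs @ [s, t, t] \<and> markers k s = zs @ [s, s] \<and>
      s \<in> set (butlast (chain (Suc k) t)))"
proof -
  define \<sigma> where "\<sigma> = chain k s"
  define c where "c = chain (Suc k) s"
  define l where "l = (LEAST i. length c \<le> Suc i \<or> halts i (\<sigma> @ [t]) \<and> \<not> halts i \<sigma>)"
  have c: "c \<noteq> []" "last c = s" unfolding c_def by (rule chain_not_Nil last_chain)+
  have "stages (\<sigma> @ [t]) (length \<sigma>) = c"
    using stages_take[of "length \<sigma>" "length \<sigma>" "\<sigma> @ [t]"] by (simp add: c_def \<sigma>_def)
  then have c': "chain (Suc k) t = take (Suc l) c @ [t]"
    by (simp add: ext \<sigma>_def[symmetric] stages_Suc l_def)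
  have l: "length c \<le> Suc l \<or> halts l (\<sigma> @ [t]) \<and> \<not> halts l \<sigma>"
    unfolding l_def by (rule LeastI[of _ "length c"]) simp
  have "l \<le> length c - 1" unfolding l_def by (rule Least_le, rule disjI1) arith
  then have lc: "l < length c" using c(1) by (cases c) auto
  have same: "halts i (\<sigma> @ [t]) \<longleftrightarrow> halts i \<sigma>" if "i < l" for i
    using not_less_Least[of i "\<lambda>i. length c \<le> Suc i \<or> halts i (\<sigma> @ [t]) \<and> \<not> halts i \<sigma>"]
      that halts_mono unfolding l_def[symmetric] by blast
  define zs where "zs = map (nth0 c) (filter (\<lambda>i. \<not> halts i \<sigma>) [0..<l])"
  have nth: "nth0 (chain (Suc k) t) i = nth0 c i" if "i \<le> l" for i
    unfolding c' using that lc by (simp add: nth0_def nth_append)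
  have mt: "markers k t = zs @ (if halts l (\<sigma> @ [t]) then [] else [nth0 c l]) @ [t, t]"
  proof -
    have "length (chain (Suc k) t) - 1 = Suc l" unfolding c' using lc by simp
    moreover have "filter (\<lambda>i. \<not> halts i (\<sigma> @ [t])) [0..<l] = filter (\<lambda>i. \<not> halts i \<sigma>) [0..<l]"
      by (rule filter_cong) (auto simp: same)
    ultimately show ?thesis
      unfolding markers_def ext \<sigma>_def[symmetric] zs_def using lc by (auto simp: nth simp del: chain.simps(2) nth0_nth)
  qed
  have anc: "c ! l \<in> set (butlast (chain (Suc k) t))"
    using lc unfolding c' by (auto simp: in_set_conv_nth intro!: exI[of _ l])
  have split: "[0..<length c - 1] = [0..<l] @ [l..<length c - 1]"
    using \<open>l \<le> length c - 1\<close> by (metis le0 le_add_diff_inverse upt_add_eq_append)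
  show ?thesis
  proof (cases "Suc l = length c")
    case True
    then have s: "s = c ! l" using c by (metis diff_Suc_1 last_conv_nth)
    have "markers k s = zs @ [s, s]"
      unfolding markers_def c_def[symmetric] \<sigma>_def[symmetric] zs_def True[symmetric] by simp
    \<comment> \<open>If program \<open>l\<close> halts at once, both copies of \<open>s\<close> go
      and \<open>u\<close> is \<open>s\<close>; otherwise one copy becomes the marker of the guess
      "diverges".\<close>
    with mt anc s lc show ?thesis by (cases "halts l (\<sigma> @ [t])") auto
  next
    case False
    with lc have "Suc l < length c" by simp
    with l have h: "halts l (\<sigma> @ [t])" "\<not> halts l \<sigma>" by auto
    have "[l..<length c - 1] = l # [Suc l..<length c - 1]"
      using \<open>Suc l < length c\<close> by (simp add: upt_conv_Cons)
    then have "\<exists>r. markers k s = zs @ c ! l # r"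
      unfolding markers_def c_def[symmetric] \<sigma>_def[symmetric] zs_def split using h lc by simp
    with mt anc h lc show ?thesis by auto
  qed
qed

lemma chain_split:
  assumes "u \<in> set (butlast (chain k t))"
  obtains s where "chain k t = chain k s @ [t]" "u = s \<or> u \<in> set (butlast (chain k s))"
proof -
  define m where "m = length (chain k t)"
  have m: "2 \<le> m" using assms by (cases "chain k t" rule: rev_cases; cases "butlast (chain k t)") (auto simp: m_def)
  define s where "s = chain k t ! (m - 2)"
  have "chain k s = butlast (chain k t)"
    using chain_nth[of "m - 2" k t] m
    by (simp add: s_def m_def butlast_conv_take numeral_2_eq_2 Suc_diff_Suc)
  moreover from this have "chain k t = chain k s @ [t]"
    by (metis append_butlast_last_id chain_last)
  moreover have "u = s \<or> u \<in> set (butlast (chain k s))"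
    using assms \<open>chain k s = butlast (chain k t)\<close>
    by (metis Un_iff append_butlast_last_id chain_last empty_iff list.set(1) set_ConsD set_append)
  ultimately show thesis using that by blast
qed

text \<open>Against the immediate predecessor the first difference is \<open>q t\<close> versus
  \<open>q u\<close> for some \<open>u\<close> above \<open>t\<close> in the level
  \<open>k + 1\<close> tree. Farther predecessors in level \<open>k\<close> follow by transitivity
  along the chain.\<close>

lemma markers_descending:
  assumes Y: "linear Y" and mem: "\<And>t. q t \<in> fst Y"
    and less: "\<And>t u. u \<in> set (butlast (chain (Suc k) t)) \<Longrightarrow> (q t, q u) \<in> snd Y \<and> q t \<noteq> q u"
  defines "e \<equiv> \<lambda>t. list_encode (map q (markers k t))"
  shows "e t \<in> fst (omega_exp Y)"
    and "u \<in> set (butlast (chain k t)) \<Longrightarrow> (e t, e u) \<in> snd (omega_exp Y) \<and> e t \<noteq> e u"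
proof -
  have str: "map q (markers k t) \<in> omega_strings Y" for t
  proof -
    have "sorted_wrt (\<lambda>u v. (q v, q u) \<in> snd Y) (markers k t)"
      by (rule sorted_wrt_mono_rel[OF _ markers_sorted]) (use less linearD(2)[OF Y mem] in auto)
    then show ?thesis using mem by (auto simp: omega_strings_def sorted_wrt_map)
  qed
  then show mem': "e t \<in> fst (omega_exp Y)" for t by (simp add: fst_omega_exp_iff e_def)
  have step: "(e t, e s) \<in> snd (omega_exp Y) \<and> e t \<noteq> e s" if "chain k t = chain k s @ [t]" for t s
    using markers_extend[OF that] str[of t] str[of s] less
    by (auto simp: e_def snd_omega_exp_iff)
  note E = linearD[OF linear_omega_exp[OF Y]]
  show "(e t, e u) \<in> snd (omega_exp Y) \<and> e t \<noteq> e u" if "u \<in> set (butlast (chain k t))"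
    using that
  proof (induction "length (chain k t)" arbitrary: t rule: less_induct)
    case less
    from less.prems obtain s where s: "chain k t = chain k s @ [t]"
      "u = s \<or> u \<in> set (butlast (chain k s))" by (rule chain_split)
    from s(2) show ?case
    proof
      assume "u \<in> set (butlast (chain k s))"
      with less.hyps[of s] s(1) have "(e s, e u) \<in> snd (omega_exp Y)" "e s \<noteq> e u" by auto
      with step[OF s(1)] show ?thesis
        using transD[OF E(3)] antisymD[OF E(4)] by metis
    qed (use step[OF s(1)] in simp)
  qed
qed

text \<open>After \<open>m\<close> exponentials the map decreases along level \<open>n - m\<close>:
  it starts at level \<open>n\<close> with the stages as elements of the Kleene-Brouwer order, and
  \<open>markers k\<close> leads from level \<open>k + 1\<close> to level \<open>k\<close>.\<close>

primrec embed :: "nat \<Rightarrow> nat \<Rightarrow> nat \<Rightarrow> nat" where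
  "embed n 0 t = t"
| "embed n (Suc m) t = list_encode (map (embed n m) (markers (n - Suc m) t))"

lemma computable_in_embed: "computable_in A (embed n m)"
proof (induction m)
  case 0
  show ?case by (simp add: computable_in_id)
next
  case (Suc m)
  show ?case unfolding embed.simps(2)[abs_def]
    by (intro comp_intros computable_in_comp[OF Suc])
qed

lemma embed_descending:
  "m \<le> n \<Longrightarrow> (\<forall>t. embed n m t \<in> fst (omega_iter m (kb_order n))) \<and>
    (\<forall>t u. u \<in> set (butlast (chain (n - m) t)) \<longrightarrow>
      (embed n m t, embed n m u) \<in> snd (omega_iter m (kb_order n)) \<and> embed n m t \<noteq> embed n m u)"
proof (induction m)
  case 0
  show ?case using kb_order_ancestor by (auto simp: omega_iter_def) (simp add: kb_order_def)
next
  case (Suc m)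
  then have "n - m = Suc (n - Suc m)" by simp
  with Suc have "\<And>t. embed n m t \<in> fst (omega_iter m (kb_order n))"
    "\<And>t u. u \<in> set (butlast (chain (Suc (n - Suc m)) t)) \<Longrightarrow>
      (embed n m t, embed n m u) \<in> snd (omega_iter m (kb_order n)) \<and> embed n m t \<noteq> embed n m u"
    by auto
  note * = markers_descending[OF linear_omega_iter[OF linear_kb_order] this]
  then show ?case by (simp add: omega_iter_Suc)
qed

text \<open>At level 0 stage \<open>i\<close> precedes stage \<open>Suc i\<close> in the tree for
  every \<open>i\<close>, so decreasing along the tree means descending.\<close>

lemma descending_omega_iter_kb_order: "descending (omega_iter n (kb_order n)) (embed n n)"
  using embed_descending[of n n] by (auto simp: descending_iff)

theorem theorem1p4:
  fixes n :: nat
  shows "(\<forall>X. comp_lin_order X \<and> (\<exists>f. computable f \<and> descending (omega_iter n X) f)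
            \<longrightarrow> (\<exists>g. computable_in (chi (jumpn n)) g \<and> descending X g))
       \<and> (\<exists>X. comp_lin_order X \<and> (\<exists>f. computable f \<and> descending (omega_iter n X) f) \<and>
            (\<forall>g. descending X g \<longrightarrow> computable_in (chi (jump g)) (chi (jumpn n))))"
proof (intro conjI allI impI exI[of _ "kb_order n"])
  fix X assume X: "comp_lin_order X \<and> (\<exists>f. computable f \<and> descending (omega_iter n X) f)"
  then have "linear X" by (auto simp: comp_lin_order_def linear_def split: prod.splits)
  moreover from X obtain f where "computable_in (chi (jumpn 0)) f" "descending (omega_iter n X) f"
    by (auto simp: computable_def chi_def[abs_def])
  ultimately show "\<exists>g. computable_in (chi (jumpn n)) g \<and> descending X g"
    using omega_iter_descending_reduce[of X 0 f n] by simp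
next
  show "\<exists>f. computable f \<and> descending (omega_iter n (kb_order n)) f"
    using computable_in_embed descending_omega_iter_kb_order unfolding computable_def by blast
next
  fix g assume "descending (kb_order n) g"
  then obtain P where "path n P" "computable_in (chi (jump g)) P"
    using descending_kb_order_computes_path by blast
  then show "computable_in (chi (jump g)) (chi (jumpn n))"
    using path_computes_jumpn computable_in_trans by blast
qed (rule comp_lin_order_kb_order)

end
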